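(* Let $\mathcal{V}(\cdot)$ be a (measurable) selection procedure assigning to each $A\in\mathbb{R}^{n\times q}$ a nonempty set $\mathcal{V}(A)\subseteq\mathcal{V}_{\mathrm{all}}$. Let $(c^0,\mathcal{V})$ be a value with $\mathbb{P}(\mathcal{C}(X)=c^0,\ \mathcal{V}(X)=\mathcal{V})>0$, where all $K$ clusters of $c^0$ are nonempty at every step, let $\mathcal{C}_1,\dots,\mathcal{C}_K$ be the final clusters determined by $c^0$, and suppose that the null hypothesis $H_{0,\mathcal{V}}$ holds for these, i.e. $\bar\mu_{\mathcal{C}_k}=\bar\mu_{\mathcal{C}_{k'}}$ for all $(k,k')\in\mathcal{V}$. Let $Q_{\sigma,J}$ be the conditional CDF of $T_\sigma=\|P_{\mathcal{E}}X\|_F/\sigma$ given $\mathcal{C}(X)=c^0$, $\mathcal{V}(X)=\mathcal{V}$ and $Z=\left(\frac{P_{\mathcal{E}}X}{\|P_{\mathcal{E}}X\|_F},\,P_{\mathcal{E}}^{\perp}X\right)$. Then (almost surely, given $\mathcal{C}(X)=c^0$ and $\mathcal{V}(X)=\mathcal{V}$) $$Q_{\sigma,J}=F_{\chi_d}(\,\cdot\,;\mathcal{S}_{\sigma,J}),$$ where $d=q\cdot\dim(\mathcal{E})$ and $F_{\chi_d}(\cdot;\mathcal{S}_{\sigma,J})$ is the CDF of the $\chi_d$ distribution truncated to $\mathcal{S}_{\sigma,J}=\mathcal{S}_\sigma\cap\mathcal{S}_{\sigma,\mathcal{V}}$, with $$\mathcal{S}_\sigma=\{\psi\ge0:\mathcal{C}(X)=\mathcal{C}(x_\sigma(\psi))\},\qquad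 \mathcal{S}_{\sigma,\mathcal{V}}=\{\psi\ge0:\mathcal{V}(X)=\mathcal{V}(x_\sigma(\psi))\},$$ $$x_\sigma(\psi)=\psi\cdot\frac{\sigma P_{\mathcal{E}}X}{\|P_{\mathcal{E}}X\|_F}+P_{\mathcal{E}}^\perp X.$$ Furthermore, with $p_{\sigma,J}=1-Q_{\sigma,J}(T_\sigma)$, for every $\alpha\in(0,1)$, $\mathbb{P}(p_{\sigma,J}\le\alpha\mid\mathcal{C}(X)=c^0,\ \mathcal{V}(X)=\mathcal{V})=\alpha$.
   Context: Write $[m]=\{1,\dots,m\}$. For a matrix $A$, $A_i$ is its $i$th row and $\|A\|_F$ its Frobenius norm. Let $n,q,K,J$ be positive integers with $2\le K\le n$, let $\sigma>0$ (known), and let $\mu\in\mathbb{R}^{n\times q}$ be a fixed matrix with rows $\mu_1,\dots,\mu_n$. $X\in\mathbb{R}^{n\times q}$ is a random matrix with independent rows $X_i\sim\mathcal{N}(\mu_i,\sigma^2I_q)$. $K$-means (Lloyd's algorithm) run on the rows of $A\in\mathbb{R}^{n\times q}$ for $J$ iterations: the initial centers $m^{(0)}_1(A),\dots,m^{(0)}_K(A)$ are $K$ rows of $A$ with distinct indices fixed independently of the data; $c_i^{(0)}(A)\in[K]$ is the index of the initial center nearest (in $\ell_2$ norm) to $A_i$; for $j\in[J]$, the $l$th center is recomputed as the average of the rows $A_s$ with $c_s^{(j-1)}(A)=l$, and $c_i^{(j)}(A)$ is the index of the recomputed center nearest to $A_i$ (ties broken by a fixed rule). The outcome is $\mathcal{C}(A)=(c_i^{(j)}(A))_{i\in[n],\,0\le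 j\le J}$, the cluster assignments at every step. It is assumed that the algorithm has $K$ nonempty clusters at every step; when this fails, $\mathcal{C}(A)$ is given a separate conventional value that is not considered. The final clusters determined by an outcome are $\mathcal{C}_k=\{i\in[n]: c_i^{(J)}=k\}$, $k\in[K]$. $\mathcal{V}_{\mathrm{all}}=\{(k,k'):k<k'\in[K]\}$. $\bar\mu_{\mathcal{C}_k}=\frac{1}{|\mathcal{C}_k|}\sum_{i\in\mathcal{C}_k}\mu_i$. $\mathbf{1}_{\mathcal{C}_k}\in\mathbb{R}^n$ is the indicator vector of $\mathcal{C}_k$, $\mathbf{v}_{k,k'}=\frac{1}{|\mathcal{C}_k|}\mathbf{1}_{\mathcal{C}_k}-\frac{1}{|\mathcal{C}_{k'}|}\mathbf{1}_{\mathcal{C}_{k'}}$, $\mathcal{E}=\mathrm{span}\{\mathbf{v}_{k,k'}:(k,k')\in\mathcal{V}\}\subseteq\mathbb{R}^n$, $P_{\mathcal{E}}\in\mathbb{R}^{n\times n}$ is the orthogonal projection onto $\mathcal{E}$, and $P_{\mathcal{E}}^\perp=I_n-P_{\mathcal{E}}$. $\chi_d$ denotes the law of $\sqrt{Y}$ with $Y\sim\chi^2_d$. The CDF of a distribution of a random variable $W$ truncated to a set $\mathcal{S}$ is $t\mapsto\mathbb{P}(W\le t,\,W\in\mathcal{S})/\mathbb{P}(W\in\mathcal{S})$. (The subscript $J$ in $Q_{\sigma,J}$, $p_{\sigma,J}$, $\mathcal{S}_{\sigma,J}$ is only a label, unrelated to the number of iterations.) *)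

theory Defs
  imports "HOL-Probability.Probability"
begin

subsection \<open>K-means (Lloyd's algorithm)\<close>

text \<open>
  A data matrix is an element of \<^typ>\<open>real^'q^'n\<close>: the row type is \<open>'n\<close>, the \<open>i\<close>-th row of \<open>A\<close>
  is \<open>A $ i\<close>, and \<^const>\<open>norm\<close> on this type is the Frobenius norm.  Cluster labels are the
  natural numbers in \<open>{1..K}\<close>.
\<close>

definition row_mean :: "real^'q^'n \<Rightarrow> 'n set \<Rightarrow> real^'q" where
  "row_mean A S = (1 / real (card S)) *\<^sub>R (\<Sum>i\<in>S. A $ i)"

text \<open>
  The tie-breaking rule \<open>tie\<close> selects one label from the set of all labels of nearest centers.
\<close>

definition tie_rule :: "nat \<Rightarrow> (nat set \<Rightarrow> nat) \<Rightarrow> bool" where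
  "tie_rule K tie \<longleftrightarrow> (\<forall>L. L \<subseteq> {1..K} \<longrightarrow> L \<noteq> {} \<longrightarrow> tie L \<in> L)"

definition nearest_center ::
  "(nat set \<Rightarrow> nat) \<Rightarrow> nat \<Rightarrow> (nat \<Rightarrow> real^'q) \<Rightarrow> real^'q \<Rightarrow> nat" where
  "nearest_center tie K m x =
     tie {l \<in> {1..K}. \<forall>l'\<in>{1..K}. norm (x - m l) \<le> norm (x - m l')}"

text \<open>
  \<open>init l\<close> is the index of the row used as the \<open>l\<close>-th initial center.
\<close>

primrec kmeans_assign ::
  "(nat set \<Rightarrow> nat) \<Rightarrow> nat \<Rightarrow> (nat \<Rightarrow> 'n) \<Rightarrow> real^'q^'n \<Rightarrow> nat \<Rightarrow> 'n \<Rightarrow> nat" where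
  "kmeans_assign tie K init A 0 =
     (\<lambda>i. nearest_center tie K (\<lambda>l. A $ init l) (A $ i))"
| "kmeans_assign tie K init A (Suc j) =
     (\<lambda>i. nearest_center tie K
        (\<lambda>l. row_mean A {s. kmeans_assign tie K init A j s = l}) (A $ i))"

text \<open>
  The outcome is the list of the assignments at the steps \<open>0, \<dots>, J\<close>; the value \<^const>\<open>None\<close> stands
  for a run in which some cluster is empty at some step.
\<close>

definition kmeans ::
  "(nat set \<Rightarrow> nat) \<Rightarrow> nat \<Rightarrow> (nat \<Rightarrow> 'n) \<Rightarrow> nat \<Rightarrow> real^'q^'n \<Rightarrow> ('n \<Rightarrow> nat) list option" where
  "kmeans tie K init J A =
     (if \<forall>j\<le>J. \<forall>l\<in>{1..K}. {i. kmeans_assign tie K init A j i = l} \<noteq> {}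
      then Some (map (kmeans_assign tie K init A) [0..<Suc J]) else None)"


subsection \<open>Hypotheses and projections\<close>

definition all_pairs :: "nat \<Rightarrow> (nat \<times> nat) set" where
  "all_pairs K = {(k, k'). k \<in> {1..K} \<and> k' \<in> {1..K} \<and> k < k'}"

definition contrast :: "(nat \<Rightarrow> 'n::finite set) \<Rightarrow> nat \<Rightarrow> nat \<Rightarrow> real^'n" where
  "contrast C k k' =
     (\<chi> i. indicator (C k) i / real (card (C k)) - indicator (C k') i / real (card (C k')))"

definition contrast_space :: "(nat \<Rightarrow> 'n::finite set) \<Rightarrow> (nat \<times> nat) set \<Rightarrow> (real^'n) set" where
  "contrast_space C V = span {contrast C k k' | k k'. (k, k') \<in> V}"

definition orth_proj :: "(real^'n) set \<Rightarrow> real^'n^'n" where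
  "orth_proj E = (THE P. \<forall>x. P *v x \<in> E \<and> (\<forall>y\<in>E. orthogonal (x - P *v x) y))"

lemma orth_proj_ex1:
  fixes E :: "(real^'n) set"
  assumes "subspace E"
  shows "\<exists>!P::real^'n^'n. \<forall>x. P *v x \<in> E \<and> (\<forall>y\<in>E. orthogonal (x - P *v x) y)"
proof -
  have uniq: "a = b"
    if "a \<in> E" "b \<in> E" "\<forall>y\<in>E. orthogonal (x - a) y" "\<forall>y\<in>E. orthogonal (x - b) y"
    for a b x :: "real^'n"
  proof -
    have "a - b \<in> E" using that assms by (simp add: subspace_diff)
    then have "(x - a) \<bullet> (a - b) = 0" "(x - b) \<bullet> (a - b) = 0"
      using that by (auto simp: orthogonal_def)
    then have "(a - b) \<bullet> (a - b) = 0"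
      by (simp add: inner_diff_left inner_diff_right algebra_simps)
    then show ?thesis by simp
  qed
  have ex: "\<exists>a\<in>E. \<forall>y\<in>E. orthogonal (x - a) y" for x :: "real^'n"
  proof -
    obtain a z where "a \<in> span E" "\<And>w. w \<in> span E \<Longrightarrow> orthogonal z w" "x = a + z"
      using orthogonal_subspace_decomp_exists[of E x] by metis
    moreover have "span E = E" using assms by simp
    ultimately show ?thesis by (intro bexI[of _ a]) auto
  qed
  then obtain f where f: "\<And>x. f x \<in> E" "\<And>x y. y \<in> E \<Longrightarrow> orthogonal (x - f x) y"
    by metis
  have "linear f"
  proof (rule linearI)
    fix x y
    show "f (x + y) = f x + f y"
    proof (rule uniq)
      show "f x + f y \<in> E" using f(1) assms by (simp add: subspace_add)
      show "\<forall>z\<in>E. orthogonal (x + y - (f x + f y)) z"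
        using f(2)[of _ x] f(2)[of _ y]
        by (simp add: orthogonal_def inner_diff_left inner_add_left)
    qed (use f in auto)
  next
    fix c x
    show "f (c *\<^sub>R x) = c *\<^sub>R f x"
    proof (rule uniq)
      show "c *\<^sub>R f x \<in> E" using f(1) assms by (simp add: subspace_scale)
      show "\<forall>z\<in>E. orthogonal (c *\<^sub>R x - c *\<^sub>R f x) z"
        using f(2)[of _ x] by (simp add: orthogonal_def inner_diff_left)
    qed (use f in auto)
  qed
  then have mf: "matrix f *v x = f x" for x by (simp add: matrix_works)
  show ?thesis
  proof (rule ex1I[of _ "matrix f"])
    show "\<forall>x. matrix f *v x \<in> E \<and> (\<forall>y\<in>E. orthogonal (x - matrix f *v x) y)"
      using f by (simp add: mf)
  next
    fix P :: "real^'n^'n"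
    assume "\<forall>x. P *v x \<in> E \<and> (\<forall>y\<in>E. orthogonal (x - P *v x) y)"
    then have "P *v x = matrix f *v x" for x
      unfolding mf using f by (intro uniq[of _ _ x]) auto
    then show "P = matrix f" by (simp add: matrix_eq)
  qed
qed


subsection \<open>Test statistic, conditioning variable and truncation set\<close>

definition test_stat :: "real^'n^'n \<Rightarrow> real \<Rightarrow> real^'q^'n \<Rightarrow> real" where
  "test_stat P \<sigma> A = norm (P ** A) / \<sigma>"

definition direction_and_rest ::
  "real^'n^'n \<Rightarrow> real^'q^'n \<Rightarrow> (real^'q^'n) \<times> (real^'q^'n)" where
  "direction_and_rest P A = ((1 / norm (P ** A)) *\<^sub>R (P ** A), (mat 1 - P) ** A)"

definition perturbed :: "real^'n^'n \<Rightarrow> real \<Rightarrow> real^'q^'n \<Rightarrow> real \<Rightarrow> real^'q^'n" where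
  "perturbed P \<sigma> A \<psi> =
     \<psi> *\<^sub>R ((1 / norm (P ** A)) *\<^sub>R (\<sigma> *\<^sub>R (P ** A))) + (mat 1 - P) ** A"

definition invariance_set ::
  "(real^'q^'n \<Rightarrow> 'c) \<Rightarrow> real^'n^'n \<Rightarrow> real \<Rightarrow> real^'q^'n \<Rightarrow> real set" where
  "invariance_set g P \<sigma> A = {\<psi>. 0 \<le> \<psi> \<and> g A = g (perturbed P \<sigma> A \<psi>)}"


subsection \<open>Distributions\<close>

text \<open>Density of \<open>N(m, \<sigma>\<^sup>2 I\<^sub>q)\<close> with respect to Lebesgue measure.\<close>

definition iso_normal_density :: "real^'q \<Rightarrow> real \<Rightarrow> real^'q \<Rightarrow> real" where
  "iso_normal_density m \<sigma> x =
     exp (- (norm (x - m))\<^sup>2 / (2 * \<sigma>\<^sup>2)) / sqrt (2 * pi * \<sigma>\<^sup>2) ^ CARD('q)"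

definition chi_square :: "nat \<Rightarrow> real measure" where
  "chi_square d =
     distr (\<Pi>\<^sub>M i\<in>{..<d}. density lborel std_normal_density) borel (\<lambda>x. \<Sum>i<d. (x i)\<^sup>2)"

definition chi :: "nat \<Rightarrow> real measure" where
  "chi d = distr (chi_square d) borel sqrt"

definition truncated_cdf :: "real measure \<Rightarrow> real set \<Rightarrow> real \<Rightarrow> real" where
  "truncated_cdf N S t = measure N ({..t} \<inter> S) / measure N S"

text \<open>
  \<open>\<kappa>\<close> is a regular conditional distribution of the real random variable \<open>T\<close> given \<open>Z\<close> under \<open>M\<close>;
  the corresponding conditional CDF is the random function \<open>\<lambda>\<omega>. cdf (\<kappa> (Z \<omega>))\<close>.
\<close>

definition regular_cond_distr ::
  "'w measure \<Rightarrow> ('w \<Rightarrow> real) \<Rightarrow> ('w \<Rightarrow> 'z::topological_space) \<Rightarrow> ('z \<Rightarrow> real measure) \<Rightarrow> bool" where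
  "regular_cond_distr M T Z \<kappa> \<longleftrightarrow>
     \<kappa> \<in> borel \<rightarrow>\<^sub>M prob_algebra borel \<and>
     (\<forall>B\<in>sets borel. AE \<omega> in M.
        real_cond_exp M (vimage_algebra (space M) Z borel) (indicator (T -` B)) \<omega>
          = measure (\<kappa> (Z \<omega>)) B)"

end

theory Submission
  imports Defs
begin

text \<open>
  Under the null hypothesis \<open>P \<mu> = 0\<close>, so the density of \<open>X\<close> factors into a function of \<open>norm (P X)\<close>
  and a function of \<open>X - P X\<close>.  The linear maps that stretch the range of \<open>P\<close> by \<open>r > 0\<close> multiply
  Lebesgue measure by a constant, and they change neither the direction of \<open>P X\<close> nor \<open>X - P X\<close>; hence
  for every event in these two variables the Lebesgue mass of \<open>{norm (P x) \<le> r}\<close> depends on \<open>r\<close> in the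
  same way up to a factor, which is independence of \<open>T\<close> and \<open>Z\<close>.  An orthonormal
  basis of the range of \<open>P\<close> gives \<open>T\<close> the chi law.  Since \<open>X\<close> is a function of \<open>(T, Z)\<close>, conditioning
  on the selection event only truncates the law of \<open>T\<close> to the section at \<open>Z\<close>, and
  the chi law has no atoms, so the p-value is uniform.
\<close>

subsection \<open>Translation-invariant measures and linear images of Lebesgue measure\<close>

text \<open>The stretching argument stands in for polar coordinates on the range of
  \<open>P\<close>. It needs only that an injective linear map multiplies Lebesgue measure by some
  positive constant, and this follows from uniqueness of translation-invariant measures. The same
  fact, with constant 1 for isometries, rotates an orthonormal basis into coordinate axes, where the
  Gaussian density is a product. Lebesgue mass is infinite, so radii are compared on half lines
  \<open>{..r}\<close>, where the mass is finite once weighted with the part of the density that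
  depends on X - P X; the Gaussian factor in the radius is restored afterwards. A conditional CDF is
  determined only almost surely, while the claim concerns every version. Hence an explicit kernel,
  the law of T restricted to a section and renormalised, is shown to be one version, and every other
  version is compared with it. Some pair is tested and its clusters are nonempty, so the contrast
  space is nonzero; with a zero projection T would be constant and the p-value could not be
  uniform.\<close>

text \<open>
  Weil's argument: integrate \<open>1\<^sub>A(x) 1\<^sub>B(y - x)\<close> in both orders, for the symmetric set \<open>B = ball 0 1\<close>.
\<close>

lemma translation_invariant_measure_unique:
  fixes m :: "'a::euclidean_space measure"
  assumes sf: "sigma_finite_measure m" and sets_m: "sets m = sets borel"
    and inv: "\<And>a. distr m borel ((+) a) = m"
    and A: "A \<in> sets borel"
  shows "emeasure m A * emeasure lborel (ball (0::'a) 1)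
       = emeasure lborel A * emeasure m (ball 0 1)"
proof -
  note sets_m [measurable_cong] A [measurable]
  define B where "B = ball (0::'a) 1"
  have [measurable]: "B \<in> sets borel" by (simp add: B_def)
  interpret m: sigma_finite_measure m by fact
  interpret pair_sigma_finite m "lborel :: 'a measure" ..
  define F where "F x y = (indicator A x * indicator B (y - x) :: ennreal)" for x y :: 'a
  \<comment> \<open>This is \<open>F (y + x) y\<close> with B(-x) rewritten as B(x) by symmetry.
    Integrated over y first, it gives the Lebesgue mass of \<open>A\<close> for each x.\<close>
  define G where "G x y = (indicator A (y + x) * indicator B x :: ennreal)" for x y :: 'a
  have inv_m: "(\<integral>\<^sup>+x. f (a + x) \<partial>m) = (\<integral>\<^sup>+x. f x \<partial>m)" if [measurable]: "f \<in> borel_measurable borel"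
    for f :: "'a \<Rightarrow> ennreal" and a
    by (subst (2) inv[symmetric, of a]) (simp add: nn_integral_distr)
  have inv_l: "(\<integral>\<^sup>+x. f (a + x) \<partial>lborel) = (\<integral>\<^sup>+x. f x \<partial>lborel)"
    if [measurable]: "f \<in> borel_measurable borel" for f :: "'a \<Rightarrow> ennreal" and a
    by (subst (2) lborel_distr_plus[symmetric, of a]) (simp add: nn_integral_distr)
  have "emeasure m A * emeasure lborel B = (\<integral>\<^sup>+x. indicator A x * emeasure lborel B \<partial>m)"
    by (simp add: nn_integral_multc sets_m)
  also have "\<dots> = (\<integral>\<^sup>+x. (\<integral>\<^sup>+y. F x y \<partial>lborel) \<partial>m)"
  proof (rule nn_integral_cong)
    fix x :: 'a
    have "(\<integral>\<^sup>+y. F x y \<partial>lborel) = (\<integral>\<^sup>+y. F x (x + y) \<partial>lborel)"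
      unfolding F_def by (rule inv_l[symmetric]) measurable
    also have "\<dots> = indicator A x * emeasure lborel B"
      unfolding F_def by (simp add: nn_integral_cmult)
    finally show "indicator A x * emeasure lborel B = (\<integral>\<^sup>+y. F x y \<partial>lborel)" ..
  qed
  also have "\<dots> = (\<integral>\<^sup>+y. (\<integral>\<^sup>+x. F x y \<partial>m) \<partial>lborel)"
    unfolding F_def by (rule Fubini'[symmetric]) measurable
  also have "\<dots> = (\<integral>\<^sup>+y. (\<integral>\<^sup>+x. G x y \<partial>m) \<partial>lborel)"
  proof (rule nn_integral_cong)
    fix y :: 'a
    have "(\<integral>\<^sup>+x. F x y \<partial>m) = (\<integral>\<^sup>+x. F (y + x) y \<partial>m)"
      unfolding F_def by (rule inv_m[symmetric]) measurable
    also have "\<dots> = (\<integral>\<^sup>+x. G x y \<partial>m)"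
      unfolding F_def G_def by (simp add: indicator_def B_def)
    finally show "(\<integral>\<^sup>+x. F x y \<partial>m) = (\<integral>\<^sup>+x. G x y \<partial>m)" .
  qed
  also have "\<dots> = (\<integral>\<^sup>+x. (\<integral>\<^sup>+y. G x y \<partial>lborel) \<partial>m)"
    unfolding G_def by (rule Fubini') measurable
  also have "\<dots> = (\<integral>\<^sup>+x. emeasure lborel A * indicator B x \<partial>m)"
  proof (rule nn_integral_cong)
    fix x :: 'a
    have "(\<integral>\<^sup>+y. G x y \<partial>lborel) = (\<integral>\<^sup>+y. indicator A (x + y) \<partial>lborel) * indicator B x"
      unfolding G_def by (simp add: nn_integral_multc add.commute)
    also have "(\<integral>\<^sup>+y. indicator A (x + y) \<partial>lborel) = emeasure lborel A"
      by (subst inv_l) simp_all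
    finally show "(\<integral>\<^sup>+y. G x y \<partial>lborel) = emeasure lborel A * indicator B x" .
  qed
  also have "\<dots> = emeasure lborel A * emeasure m B"
    by (simp add: nn_integral_cmult sets_m)
  finally show ?thesis by (simp add: B_def)
qed

lemma emeasure_lborel_open_pos:
  fixes S :: "'a::euclidean_space set"
  assumes "open S" "S \<noteq> {}"
  shows "0 < emeasure lborel S"
proof -
  obtain x e where "0 < e" "ball x e \<subseteq> S"
    using assms by (metis ex_in_conv openE)
  moreover have "emeasure lborel (ball x e) > 0"
  proof -
    have "\<not> negligible (ball x e)"
      using \<open>0 < e\<close> by (simp add: open_not_negligible)
    then have "emeasure lborel (ball x e) \<noteq> 0"
      by (simp add: negligible_iff_null_sets null_sets_def emeasure_completion)
    then show ?thesis by (simp add: zero_less_iff_neq_zero)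
  qed
  ultimately show ?thesis
    using emeasure_mono[of "ball x e" S lborel] assms by (simp add: order.strict_trans2)
qed

text \<open>A shift by a after \<open>g\<close> is a shift by the preimage of a before
  \<open>g\<close>, so the image of Lebesgue measure under \<open>g\<close> is translation invariant
  and hence a multiple of Lebesgue measure. The multiple, which is 1 / |det g|, is read off from the
  unit ball; isometries preserve the ball, which forces 1.\<close>

lemma nn_integral_lborel_linear:
  fixes g :: "'a::euclidean_space \<Rightarrow> 'a"
  assumes "linear g" "inj g"
  obtains c :: real where "0 < c"
    and "\<And>f. f \<in> borel_measurable borel \<Longrightarrow>
      (\<integral>\<^sup>+x. f (g x) \<partial>lborel) = ennreal c * (\<integral>\<^sup>+x. f x \<partial>lborel)"
    and "(\<And>x. norm (g x) = norm x) \<Longrightarrow> c = 1"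
proof -
  interpret g: linear g by fact
  have bij: "bij g"
    using assms by (simp add: bij_def linear_inj_imp_surj)
  define h where "h = inv g"
  have gh: "g (h x) = x" and hg: "h (g x) = x" for x
    using bij by (simp_all add: h_def bij_is_surj surj_f_inv_f bij_is_inj)
  have lin_h: "linear h"
    using assms bij h_def by (metis inj_linear_imp_inv_linear)
  have cont_g: "continuous_on UNIV g" and cont_h: "continuous_on UNIV h"
    using assms lin_h by (auto intro: linear_continuous_on linear_conv_bounded_linear[THEN iffD1])
  have [measurable]: "g \<in> borel_measurable borel" "h \<in> borel_measurable borel"
    using cont_g cont_h by (auto intro: borel_measurable_continuous_onI)
  let ?B = "ball (0::'a) 1"
  define m where "m = distr lborel borel g"
  have [simp, measurable_cong]: "sets m = sets borel" by (simp add: m_def)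
  have sf: "sigma_finite_measure m"
  proof -
    \<comment> \<open>Sigma-finiteness passes from an image measure back to its source, so it is
      enough to push \<open>m\<close> forward to Lebesgue measure.\<close>
    have "distr m lborel h = lborel"
      unfolding m_def by (subst distr_distr) (auto simp: hg comp_def distr_id2)
    then show ?thesis
      by (intro sigma_finite_measure_distr[of m lborel h]) (auto simp: sigma_finite_lborel)
  qed
  have inv: "distr m borel ((+) a) = m" for a
  proof -
    have "distr m borel ((+) a) = distr lborel borel (\<lambda>x. g (h a + x))"
      unfolding m_def by (subst distr_distr) (auto simp: comp_def g.add gh)
    also have "\<dots> = distr (distr lborel borel ((+) (h a))) borel g"
      by (subst distr_distr) (auto simp: comp_def)
    finally show ?thesis by (simp add: lborel_distr_plus m_def)
  qed
  have vimage_B: "g -` ?B = h ` ?B"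
    using bij unfolding h_def by (rule bij_vimage_eq_inv_image)
  have mB: "emeasure m ?B = emeasure lborel (h ` ?B)"
    by (simp add: m_def emeasure_distr vimage_B)
  have h_open: "open (h ` ?B)"
    using open_vimage[OF open_ball cont_g] vimage_B by metis
  have "bounded (h ` ?B)"
    using lin_h by (simp add: bounded_linear_image linear_conv_bounded_linear)
  then have mB_fin: "emeasure m ?B < \<infinity>"
    unfolding mB by (rule emeasure_bounded_finite)
  have mB_pos: "emeasure m ?B > 0"
    unfolding mB by (intro emeasure_lborel_open_pos h_open) auto
  have lB_fin: "emeasure lborel ?B < \<infinity>" and lB_pos: "emeasure lborel ?B > 0"
    using emeasure_bounded_finite[OF bounded_ball, of 0 1]
    by (auto intro: emeasure_lborel_open_pos)
  define c where "c = measure m ?B / measure lborel ?B"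
  have meas_pos: "measure m ?B > 0" "measure lborel ?B > 0"
    using mB_pos mB_fin lB_pos lB_fin by (auto simp: measure_def enn2real_positive_iff)
  then have "0 < c" by (simp add: c_def)
  have m_eq: "m = density lborel (\<lambda>_. ennreal c)"
  proof (rule measure_eqI)
    fix A assume "A \<in> sets m"
    then have A: "A \<in> sets borel" by simp
    have e: "emeasure m ?B = ennreal (measure m ?B)" "emeasure lborel ?B = ennreal (measure lborel ?B)"
      using mB_fin lB_fin by (simp_all add: emeasure_eq_ennreal_measure less_top)
    have "emeasure m A * ennreal (measure lborel ?B) = emeasure lborel A * ennreal (c * measure lborel ?B)"
      using translation_invariant_measure_unique[OF sf _ inv A] meas_pos
      by (simp add: e c_def)
    also have "\<dots> = (ennreal c * emeasure lborel A) * ennreal (measure lborel ?B)"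
      using \<open>0 < c\<close> by (simp add: ennreal_mult mult_ac)
    finally have "emeasure m A = ennreal c * emeasure lborel A"
      using meas_pos by (simp add: mult_right_ennreal_cancel not_le)
    then show "emeasure m A = emeasure (density lborel (\<lambda>_. ennreal c)) A"
      using A by (simp add: emeasure_density nn_integral_cmult)
  qed simp
  show thesis
  proof
    show "0 < c" by fact
    fix f :: "'a \<Rightarrow> ennreal" assume [measurable]: "f \<in> borel_measurable borel"
    have "(\<integral>\<^sup>+x. f (g x) \<partial>lborel) = (\<integral>\<^sup>+x. f x \<partial>m)"
      by (simp add: m_def nn_integral_distr)
    also have "\<dots> = ennreal c * (\<integral>\<^sup>+x. f x \<partial>lborel)"
      by (simp add: m_eq nn_integral_density nn_integral_cmult)
    finally show "(\<integral>\<^sup>+x. f (g x) \<partial>lborel) = ennreal c * (\<integral>\<^sup>+x. f x \<partial>lborel)" .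
  next
    assume iso: "\<And>x. norm (g x) = norm x"
    have "g -` ?B = ?B" by (auto simp: iso)
    then have "emeasure m ?B = emeasure lborel ?B"
      by (simp add: m_def emeasure_distr)
    then show "c = 1" using meas_pos by (simp add: c_def measure_def)
  qed
qed

subsection \<open>Isotropic Gaussian densities and the chi law\<close>

text \<open>The formula of \<open>iso_normal_density\<close> on any Euclidean space, so that single
  rows and the whole matrix, whose norm is the Frobenius norm, are treated by the same
  lemmas.\<close>

definition isotropic_density :: "'a::euclidean_space \<Rightarrow> real \<Rightarrow> 'a \<Rightarrow> real" where
  "isotropic_density m \<sigma> x =
     exp (- (norm (x - m))\<^sup>2 / (2 * \<sigma>\<^sup>2)) / sqrt (2 * pi * \<sigma>\<^sup>2) ^ DIM('a)"

lemma isotropic_density_nonneg [simp]: "0 \<le> isotropic_density m \<sigma> x"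
  by (simp add: isotropic_density_def)

lemma borel_measurable_isotropic_density [measurable]: "isotropic_density m \<sigma> \<in> borel_measurable borel"
  unfolding isotropic_density_def[abs_def] by measurable

lemma isotropic_density_prod:
  "isotropic_density m \<sigma> x = (\<Prod>b\<in>Basis. normal_density (m \<bullet> b) \<sigma> (x \<bullet> b))"
proof -
  have "(norm (x - m))\<^sup>2 = (\<Sum>b\<in>Basis. ((x \<bullet> b) - (m \<bullet> b))\<^sup>2)"
    unfolding power2_norm_eq_inner
    by (subst euclidean_inner) (simp add: power2_eq_square inner_diff_left)
  then have "exp (- (norm (x - m))\<^sup>2 / (2 * \<sigma>\<^sup>2))
      = (\<Prod>b\<in>Basis. exp (- ((x \<bullet> b) - (m \<bullet> b))\<^sup>2 / (2 * \<sigma>\<^sup>2)))"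
    by (simp add: exp_sum[symmetric] sum_negf sum_divide_distrib)
  then show ?thesis
    by (simp add: isotropic_density_def normal_density_def prod_dividef)
qed

text \<open>An orthonormal basis of the orthogonal complement completes \<open>B\<close> to an
  orthonormal basis of the space; a bijection from the standard basis onto it extends linearly to an
  isometry, and \<open>D\<close> collects the standard vectors sent into \<open>B\<close>.\<close>

lemma orthonormal_rotation:
  fixes B :: "'a::euclidean_space set"
  assumes orth: "pairwise orthogonal B" and norm1: "\<And>b. b \<in> B \<Longrightarrow> norm b = 1"
  obtains g :: "'a \<Rightarrow> 'a" and D where "linear g" "\<And>x. norm (g x) = norm x" "D \<subseteq> Basis" "inj_on g D" "g ` D = B"
proof -
  define S where "S = {y \<in> UNIV. \<forall>x\<in>span B. orthogonal x y}"
  have dim_S: "dim S + dim (span B) = DIM('a)"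
    using dim_subspace_orthogonal_to_vectors[of "span B" "UNIV :: 'a set"] by (simp add: S_def)
  have "subspace S"
    unfolding S_def by (auto simp: subspace_def orthogonal_clauses)
  then obtain B' where B': "B' \<subseteq> S" "pairwise orthogonal B'" "\<And>x. x \<in> B' \<Longrightarrow> norm x = 1"
    "independent B'" "card B' = dim S"
    by (metis orthonormal_basis_subspace)
  have "0 \<notin> B" using norm1 by force
  then have indB: "independent B" using orth by (rule pairwise_orthogonal_independent[rotated])
  have fin: "finite B" "finite B'" using indB B'(4) independent_imp_finite by auto
  have disj: "B \<inter> B' = {}"
  proof (rule equals0I)
    fix x assume "x \<in> B \<inter> B'"
    then have "orthogonal x x" using B'(1) by (auto simp: S_def span_base)
    then show False using \<open>0 \<notin> B\<close> \<open>x \<in> B \<inter> B'\<close> by (simp add: orthogonal_self)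
  qed
  have "orthogonal x y" if "x \<in> B" "y \<in> B'" for x y
    using that B'(1) by (auto simp: S_def span_base)
  then have orthU: "pairwise orthogonal (B \<union> B')"
    using orth B'(2) unfolding pairwise_def by (metis UnE orthogonal_commute)
  have norm1U: "norm b = 1" if "b \<in> B \<union> B'" for b using that norm1 B'(3) by auto
  have "card (B \<union> B') = DIM('a)"
    using dim_S fin disj B'(5) by (simp add: card_Un_disjoint dim_eq_card_independent indB)
  then obtain e where e: "bij_betw e (Basis::'a set) (B \<union> B')"
    using fin by (metis bij_betw_iff_card finite_Basis finite_UnI)
  define g where "g x = (\<Sum>b\<in>Basis. (x \<bullet> b) *\<^sub>R e b)" for x :: 'a
  have g_Basis: "g b = e b" if "b \<in> Basis" for b
  proof -
    have "g b = (\<Sum>b'\<in>Basis. if b' = b then e b' else 0)"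
      unfolding g_def by (rule sum.cong) (use that in \<open>auto simp: inner_Basis\<close>)
    then show ?thesis using that by simp
  qed
  have inj_e: "inj_on e Basis" using e by (simp add: bij_betw_def)
  have eB: "e b \<in> B \<union> B'" if "b \<in> Basis" for b using e that by (auto simp: bij_betw_def)
  have lin_g: "linear g"
    by (rule linearI) (simp_all add: g_def inner_add_left scaleR_add_left sum.distrib
        scaleR_sum_right)
  have norm_g: "norm (g x) = norm x" for x
  proof -
    have "(norm (g x))\<^sup>2 = (\<Sum>b\<in>Basis. (norm ((x \<bullet> b) *\<^sub>R e b))\<^sup>2)"
      unfolding g_def
    proof (rule norm_sum_Pythagorean)
      show "pairwise (\<lambda>i j. orthogonal ((x \<bullet> i) *\<^sub>R e i) ((x \<bullet> j) *\<^sub>R e j)) Basis"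
        using orthU eB inj_e unfolding pairwise_def inj_on_def
        by (metis orthogonal_clauses(2) orthogonal_clauses(7) orthogonal_scaleR)
    qed simp
    also have "\<dots> = (\<Sum>b\<in>Basis. (x \<bullet> b)\<^sup>2)"
      using norm1U eB by (intro sum.cong) (auto simp: power_mult_distrib)
    also have "\<dots> = (norm x)\<^sup>2"
      unfolding power2_norm_eq_inner by (subst euclidean_inner) (simp add: power2_eq_square)
    finally show ?thesis by simp
  qed
  have inj_g: "inj_on g {b \<in> Basis. e b \<in> B}"
    using inj_e by (auto simp: inj_on_def g_Basis)
  have img: "g ` {b \<in> Basis. e b \<in> B} = B"
  proof
    show "B \<subseteq> g ` {b \<in> Basis. e b \<in> B}"
    proof
      fix b assume "b \<in> B"
      then obtain i where "i \<in> Basis" "e i = b"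
        using e unfolding bij_betw_def by (metis UnI1 imageE)
      then show "b \<in> g ` {b \<in> Basis. e b \<in> B}" using \<open>b \<in> B\<close> g_Basis by force
    qed
  qed (auto simp: g_Basis)
  show thesis
    by (rule that[OF lin_g norm_g _ inj_g img]) blast
qed

lemma norm_orthonormal_sum:
  assumes "pairwise orthogonal B" "\<And>b. b \<in> B \<Longrightarrow> norm b = 1" "finite B"
  shows "(norm (\<Sum>b\<in>B. c b *\<^sub>R b))\<^sup>2 = (\<Sum>b\<in>B. (c b)\<^sup>2)"
proof -
  have "(norm (\<Sum>b\<in>B. c b *\<^sub>R b))\<^sup>2 = (\<Sum>b\<in>B. (norm (c b *\<^sub>R b))\<^sup>2)"
  proof (rule norm_sum_Pythagorean)
    show "pairwise (\<lambda>i j. orthogonal (c i *\<^sub>R i) (c j *\<^sub>R j)) B"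
      using assms(1) by (simp add: pairwise_def orthogonal_clauses)
  qed fact
  then show ?thesis using assms by (simp add: power_mult_distrib)
qed

text \<open>In the substitution x = \<sigma> y the Jacobian cancels the 1/\<sigma> of the
  density.\<close>

lemma nn_integral_normal_density_scaled:
  assumes [arith]: "0 < \<sigma>" and [measurable]: "f \<in> borel_measurable borel"
  shows "(\<integral>\<^sup>+x. ennreal (normal_density 0 \<sigma> x) * f (x / \<sigma>) \<partial>lborel)
       = (\<integral>\<^sup>+x. ennreal (std_normal_density x) * f x \<partial>lborel)"
proof -
  have "(\<integral>\<^sup>+x. ennreal (normal_density 0 \<sigma> x) * f (x / \<sigma>) \<partial>lborel)
      = ennreal \<sigma> * (\<integral>\<^sup>+x. ennreal (normal_density 0 \<sigma> (\<sigma> * x)) * f x \<partial>lborel)"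
    by (subst nn_integral_real_affine[where c=\<sigma> and t=0]) auto
  also have "\<dots> = (\<integral>\<^sup>+x. ennreal (std_normal_density x) * f x \<partial>lborel)"
    by (subst nn_integral_cmult[symmetric])
      (auto intro!: nn_integral_cong simp: normal_density_def ennreal_mult[symmetric]
        mult.assoc[symmetric] real_sqrt_mult power_mult_distrib)
  finally show ?thesis .
qed

text \<open>In the rotated coordinates the density is a product, and the coefficients along
  \<open>B\<close> are the coordinates in \<open>D\<close>, which have mean zero. Divided by
  \<sigma> they are independent standard normal, and by Pythagoras the root of their sum of squares
  is the scaled norm. \<open>h\<close> numbers \<open>D\<close> to match the index set in
  \<open>chi_square\<close>.\<close>

lemma distr_norm_projection_chi:
  fixes X :: "'w \<Rightarrow> 'a::euclidean_space"
  assumes "prob_space M" and \<sigma>: "0 < \<sigma>"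
    and X: "distributed M lborel X (\<lambda>x. ennreal (isotropic_density m \<sigma> x))"
    and orth: "pairwise orthogonal B" and norm1: "\<And>b. b \<in> B \<Longrightarrow> norm b = 1"
    and m: "\<And>b. b \<in> B \<Longrightarrow> m \<bullet> b = 0"
  shows "distr M borel (\<lambda>\<omega>. norm (\<Sum>b\<in>B. (X \<omega> \<bullet> b) *\<^sub>R b) / \<sigma>) = chi (card B)"
proof -
  interpret prob_space M by fact
  obtain g :: "'a \<Rightarrow> 'a" and D where g: "linear g" and iso: "\<And>x. norm (g x) = norm x"
    and D: "D \<subseteq> Basis" "inj_on g D" "g ` D = B"
    using orthonormal_rotation[OF orth norm1] by metis
  have finD: "finite D" using D(1) finite_Basis finite_subset by blast
  have finB: "finite B" and cardB: "card B = card D"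
    using D finD by (auto simp: card_image)
  define d where "d = card D"
  obtain h where h: "bij_betw h {..<d} D"
    using finD by (metis bij_betw_iff_card card_lessThan d_def finite_lessThan)
  have inj_g: "inj g"
    using iso g by (metis linear_injective_0 norm_eq_zero)
  then have "surj g" by (rule linear_inj_imp_surj[OF g])
  \<comment> \<open>The mean in rotated coordinates; isometry turns the hypothesis on
    \<open>m\<close> into vanishing of its coordinates in \<open>D\<close>.\<close>
  then obtain n where n: "g n = m" by (metis surjD)
  have inner_g: "g x \<bullet> g y = x \<bullet> y" for x y
    using iso g by (metis orthogonal_transformation orthogonal_transformation_def)
  have g_meas [measurable]: "g \<in> borel_measurable borel"
    using g by (auto intro: borel_measurable_continuous_onI linear_continuous_on linear_conv_bounded_linear[THEN iffD1])
  have [measurable]: "X \<in> borel_measurable M"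
    using distributed_measurable[OF X] by simp
  have rot: "(\<integral>\<^sup>+x. f (g x) \<partial>lborel) = (\<integral>\<^sup>+x. f x \<partial>lborel)"
    if "f \<in> borel_measurable borel" for f :: "'a \<Rightarrow> ennreal"
    using nn_integral_lborel_linear[OF g inj_g] that iso by (metis ennreal_1 mult_1)
  have dens_g: "isotropic_density m \<sigma> (g y) = isotropic_density n \<sigma> y" for y
  proof -
    have "norm (g y - m) = norm (y - n)"
      using g iso n by (metis linear_diff)
    then show ?thesis by (simp add: isotropic_density_def)
  qed
  have n0: "n \<bullet> b = 0" if "b \<in> D" for b
    using m[of "g b"] D that inner_g n by auto
  define Y where "Y \<omega> = (\<lambda>i\<in>{..<d}. (X \<omega> \<bullet> g (h i)) / \<sigma>)" for \<omega>
  have Y_meas [measurable]: "Y \<in> M \<rightarrow>\<^sub>M (\<Pi>\<^sub>M i\<in>{..<d}. borel)"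
    unfolding Y_def by measurable
  let ?N = "density lborel (\<lambda>x. ennreal (std_normal_density x))"
  interpret N: prob_space ?N by (rule prob_space_normal_density) simp
  interpret product_sigma_finite "\<lambda>_::nat. ?N" ..
  have law: "distr M (\<Pi>\<^sub>M i\<in>{..<d}. borel) Y = (\<Pi>\<^sub>M i\<in>{..<d}. ?N)"
  proof (rule PiM_eqI)
    show "sets (distr M (\<Pi>\<^sub>M i\<in>{..<d}. borel) Y) = sets (\<Pi>\<^sub>M i\<in>{..<d}. ?N)"
      by (simp cong: sets_PiM_cong)
    fix A :: "nat \<Rightarrow> real set" assume "\<And>i. i \<in> {..<d} \<Longrightarrow> A i \<in> sets ?N"
    then have A [measurable]: "i < d \<Longrightarrow> A i \<in> sets borel" for i by simp
    define k where "k = the_inv_into {..<d} h"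
    have k: "k (h i) = i" if "i < d" for i
      using h that unfolding k_def bij_betw_def by (simp add: the_inv_into_f_f)
    have k_less: "k b < d" if "b \<in> D" for b
      using h that k unfolding bij_betw_def by auto
    \<comment> \<open>The contribution of coordinate \<open>b\<close> to the probability of a
      rectangle: coordinates in \<open>D\<close> carry a constraint, found through the inverse
      numbering \<open>k\<close>; all others integrate to 1.\<close>
    define u where "u b t = ennreal (normal_density (n \<bullet> b) \<sigma> t) *
      (if b \<in> D then indicator (A (k b)) (t / \<sigma>) else 1)" for b t
    have [measurable]: "u b \<in> borel_measurable borel" for b
    proof (cases "b \<in> D")
      case True
      then have [measurable]: "A (k b) \<in> sets borel" using k_less by simp
      show ?thesis using True unfolding u_def[abs_def] by simp
    qed (simp add: u_def[abs_def])
    have E [measurable]: "{x. \<forall>i<d. (x \<bullet> g (h i)) / \<sigma> \<in> A i} \<in> sets borel"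
    proof -
      have "{x. \<forall>i<d. (x \<bullet> g (h i)) / \<sigma> \<in> A i} =
          (\<Inter>i\<in>{..<d}. (\<lambda>x. (x \<bullet> g (h i)) / \<sigma>) -` A i \<inter> space borel) \<inter> UNIV" by auto
      also have "\<dots> \<in> sets borel"
      \<comment> \<open>Closure under finite intersections requires a nonempty index set; the empty
        intersection is the whole space.\<close>
      proof (cases "d = 0")
        case False
        then have "(\<Inter>i\<in>{..<d}. (\<lambda>x. (x \<bullet> g (h i)) / \<sigma>) -` A i \<inter> space borel) \<in> sets borel"
          using A by (intro sets.finite_INT measurable_sets[where A=borel]) auto
        then show ?thesis by simp
      qed simp
      finally show ?thesis .
    qed
    have "Pi\<^sub>E {..<d} A \<in> sets (\<Pi>\<^sub>M i\<in>{..<d}. borel)"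
      by (intro sets_PiM_I_finite) auto
    moreover have "Y -` Pi\<^sub>E {..<d} A = X -` {x. \<forall>i<d. (x \<bullet> g (h i)) / \<sigma> \<in> A i}"
      by (rule set_eqI) (auto simp: Y_def restrict_PiE_iff Pi_iff)
    ultimately have "emeasure (distr M (\<Pi>\<^sub>M i\<in>{..<d}. borel) Y) (Pi\<^sub>E {..<d} A)
        = emeasure M (X -` {x. \<forall>i<d. (x \<bullet> g (h i)) / \<sigma> \<in> A i} \<inter> space M)"
      by (subst emeasure_distr) auto
    also have "\<dots> = (\<integral>\<^sup>+x. ennreal (isotropic_density m \<sigma> x) *
        indicator {x. \<forall>i<d. (x \<bullet> g (h i)) / \<sigma> \<in> A i} x \<partial>lborel)"
      using E by (intro distributed_emeasure[OF X]) simp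
    also have "\<dots> = (\<integral>\<^sup>+y. ennreal (isotropic_density m \<sigma> (g y)) *
        indicator {x. \<forall>i<d. (x \<bullet> g (h i)) / \<sigma> \<in> A i} (g y) \<partial>lborel)"
      by (rule rot[symmetric]) measurable
    also have "\<dots> = (\<integral>\<^sup>+y. (\<Prod>b\<in>Basis. u b (y \<bullet> b)) \<partial>lborel)"
    proof (rule nn_integral_cong)
      fix y :: 'a
      have "indicator {x. \<forall>i<d. (x \<bullet> g (h i)) / \<sigma> \<in> A i} (g y)
          = (\<Prod>i<d. indicator (A i) ((y \<bullet> h i) / \<sigma>) :: ennreal)"
        by (auto simp: indicator_def inner_g prod_zero_iff)
      also have "\<dots> = (\<Prod>i<d. indicator (A (k (h i))) ((y \<bullet> h i) / \<sigma>))"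
        by (intro prod.cong) (auto simp: k)
      also have "\<dots> = (\<Prod>b\<in>D. indicator (A (k b)) ((y \<bullet> b) / \<sigma>))"
        by (rule prod.reindex_bij_betw[OF h])
      also have "\<dots> = (\<Prod>b\<in>Basis. if b \<in> D then indicator (A (k b)) ((y \<bullet> b) / \<sigma>) else 1)"
        using D(1) by (simp add: prod.If_cases Int_absorb1)
      finally show "ennreal (isotropic_density m \<sigma> (g y)) *
        indicator {x. \<forall>i<d. (x \<bullet> g (h i)) / \<sigma> \<in> A i} (g y) = (\<Prod>b\<in>Basis. u b (y \<bullet> b))"
        unfolding dens_g isotropic_density_prod[of n] by (simp add: prod_ennreal[symmetric] u_def prod.distrib)
    qed
    also have "\<dots> = (\<Prod>b\<in>Basis. \<integral>\<^sup>+t. u b t \<partial>lborel)"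
      by (rule nn_integral_lborel_prod) auto
    also have "\<dots> = (\<Prod>b\<in>Basis. if b \<in> D then emeasure ?N (A (k b)) else 1)"
    proof (rule prod.cong)
      fix b :: 'a assume "b \<in> Basis"
      show "(\<integral>\<^sup>+t. u b t \<partial>lborel) = (if b \<in> D then emeasure ?N (A (k b)) else 1)"
      proof (cases "b \<in> D")
        case True
        then have [measurable]: "A (k b) \<in> sets borel" using k_less by simp
        have "(\<integral>\<^sup>+t. u b t \<partial>lborel) = (\<integral>\<^sup>+x. ennreal (std_normal_density x) * indicator (A (k b)) x \<partial>lborel)"
          unfolding u_def using True n0 \<sigma>
            nn_integral_normal_density_scaled[of \<sigma> "indicator (A (k b))"] by simp
        then show ?thesis using True by (simp add: emeasure_density)
      next
        case False
        have "prob_space (density lborel (normal_density (n \<bullet> b) \<sigma>))"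
          using \<sigma> by (rule prob_space_normal_density)
        then have "(\<integral>\<^sup>+t. ennreal (normal_density (n \<bullet> b) \<sigma> t) \<partial>lborel) = 1"
          using prob_space.emeasure_space_1 by (fastforce simp: emeasure_density)
        then show ?thesis using False by (simp add: u_def)
      qed
    qed simp
    also have "\<dots> = (\<Prod>b\<in>D. emeasure ?N (A (k b)))"
      using D(1) by (simp add: prod.If_cases Int_absorb1)
    also have "\<dots> = (\<Prod>i<d. emeasure ?N (A i))"
      by (rule prod.reindex_bij_betw[OF h, of "\<lambda>b. emeasure ?N (A (k b))", symmetric, THEN trans])
        (auto simp: k intro!: prod.cong)
    finally show "emeasure (distr M (\<Pi>\<^sub>M i\<in>{..<d}. borel) Y) (Pi\<^sub>E {..<d} A)
      = (\<Prod>i\<in>{..<d}. emeasure ?N (A i))" .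
  qed simp
  have norm_eq: "norm (\<Sum>b\<in>B. (X \<omega> \<bullet> b) *\<^sub>R b) / \<sigma> = sqrt (\<Sum>i<d. (Y \<omega> i)\<^sup>2)" for \<omega>
  proof -
    have gh: "bij_betw (g \<circ> h) {..<d} B"
      using h D(2,3) by (intro bij_betw_trans) (auto simp: bij_betw_def)
    have "(norm (\<Sum>b\<in>B. (X \<omega> \<bullet> b) *\<^sub>R b))\<^sup>2 = (\<Sum>b\<in>B. (X \<omega> \<bullet> b)\<^sup>2)"
      by (rule norm_orthonormal_sum[OF orth norm1 finB])
    also have "\<dots> = (\<Sum>i<d. (X \<omega> \<bullet> g (h i))\<^sup>2)"
      using sum.reindex_bij_betw[OF gh, of "\<lambda>b. (X \<omega> \<bullet> b)\<^sup>2"] by simp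
    also have "\<dots> = \<sigma>\<^sup>2 * (\<Sum>i<d. (Y \<omega> i)\<^sup>2)"
      using \<sigma> by (simp add: Y_def sum_distrib_left power_divide)
    finally have "norm (\<Sum>b\<in>B. (X \<omega> \<bullet> b) *\<^sub>R b) = sqrt (\<sigma>\<^sup>2 * (\<Sum>i<d. (Y \<omega> i)\<^sup>2))"
      by (metis norm_ge_zero real_sqrt_unique)
    then show ?thesis using \<sigma> by (simp add: real_sqrt_mult)
  qed
  have "chi (card B) = distr (\<Pi>\<^sub>M i\<in>{..<d}. ?N) borel (\<lambda>x. sqrt (\<Sum>i<d. (x i)\<^sup>2))"
    unfolding chi_def chi_square_def cardB d_def[symmetric]
    by (subst distr_distr) (auto simp: comp_def)
  also have "\<dots> = distr M borel (\<lambda>\<omega>. sqrt (\<Sum>i<d. (Y \<omega> i)\<^sup>2))"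
    unfolding law[symmetric] by (subst distr_distr) (auto simp: comp_def)
  finally show ?thesis by (simp add: norm_eq)
qed

subsection \<open>Independence of the length of a projection\<close>

text \<open>Forgets the matrix structure of A \<mapsto> P A: an orthogonal projection
  \<open>p\<close> of a Euclidean space that kills the Gaussian mean. A zero projection is excluded
  since the radius would then be an atom at 0.\<close>

locale gaussian_projection = prob_space M for M :: "'w measure" +
  fixes X :: "'w \<Rightarrow> 'a::euclidean_space" and m :: 'a and \<sigma> :: real and p :: "'a \<Rightarrow> 'a"
  assumes \<sigma>: "0 < \<sigma>"
    and X: "distributed M lborel X (\<lambda>x. ennreal (isotropic_density m \<sigma> x))"
    and lin: "linear p" and idem: "\<And>x. p (p x) = p x"
    and orth: "\<And>x y. (x - p x) \<bullet> p y = 0"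
    and pm: "p m = 0" and nontrivial: "\<exists>z. p z \<noteq> 0"
begin

sublocale p: linear p by (rule lin)

definition radius :: "'a \<Rightarrow> real" where "radius x = norm (p x)"

definition shape :: "'a \<Rightarrow> 'a \<times> 'a" where "shape x = ((1 / norm (p x)) *\<^sub>R p x, x - p x)"

definition stretch :: "real \<Rightarrow> 'a \<Rightarrow> 'a" where "stretch r x = r *\<^sub>R p x + (x - p x)"

definition radial :: "real \<Rightarrow> real" where "radial r = exp (- r\<^sup>2 / (2 * \<sigma>\<^sup>2))"

text \<open>Keeps the full normalising constant of the density, which is why \<open>radial\<close>
  has none.\<close>

definition resid :: "'a \<Rightarrow> real" where "resid x = isotropic_density m \<sigma> (x - p x)"

text \<open>The distribution of the radius over the points with shape in \<open>A\<close>, under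
  Lebesgue measure weighted by \<open>resid\<close> alone. Leaving out the factor
  \<open>radial\<close> makes stretches act on it by pure scaling.\<close>

definition radial_measure :: "('a \<times> 'a) set \<Rightarrow> real measure" where
  "radial_measure A = distr (density lborel (\<lambda>x. indicator A (shape x) * ennreal (resid x))) borel radius"

lemma p_measurable [measurable]: "p \<in> borel_measurable borel"
  using lin by (auto intro: borel_measurable_continuous_onI linear_continuous_on linear_conv_bounded_linear[THEN iffD1])

lemma measurable_radius_shape [measurable]:
  "radius \<in> borel_measurable borel" "shape \<in> borel_measurable borel" "resid \<in> borel_measurable borel"
  "radial \<in> borel_measurable borel"
  unfolding radius_def[abs_def] shape_def[abs_def] resid_def[abs_def] radial_def[abs_def] by measurable

lemma X_measurable [measurable]: "X \<in> borel_measurable M"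
  using distributed_measurable[OF X] by simp

section \<open>How stretches act on radius, shape and residual\<close>

lemma p_stretch: "p (stretch r x) = r *\<^sub>R p x"
  by (simp add: stretch_def p.add p.scale p.diff idem)

lemma stretch_resid: "stretch r x - p (stretch r x) = x - p x"
  by (simp only: p_stretch) (simp add: stretch_def)

lemma radius_stretch: "0 < r \<Longrightarrow> radius (stretch r x) = r * radius x"
  by (simp add: radius_def p_stretch)

lemma shape_stretch: "0 < r \<Longrightarrow> shape (stretch r x) = shape x"
  by (simp add: shape_def stretch_resid) (simp add: p_stretch)

lemma resid_stretch: "resid (stretch r x) = resid x"
  by (simp add: resid_def stretch_resid)

lemma linear_stretch: "linear (stretch r)"
  by (rule linearI) (simp_all add: stretch_def p.add p.scale algebra_simps)

lemma inj_stretch: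
  assumes "0 < r" shows "inj (stretch r)"
proof (subst linear_injective_0[OF linear_stretch], intro allI impI)
  fix x assume *: "stretch r x = 0"
  then have "r *\<^sub>R p x = 0" by (metis p_stretch p.zero)
  then have "p x = 0" using assms by simp
  then show "x = 0" using * by (simp add: stretch_def)
qed

text \<open>Since \<open>p m = 0\<close>, the mean is orthogonal to the range of \<open>p\<close>,
  so \<open>p x\<close> and \<open>x - p x - m\<close> are orthogonal and Pythagoras splits the
  exponent.\<close>

lemma density_split: "isotropic_density m \<sigma> x = radial (radius x) * resid x"
proof -
  have "p x \<bullet> m = 0"
    using orth[of m x] by (simp add: pm inner_commute)
  then have "orthogonal (p x) (x - p x - m)"
    using orth[of x x] by (simp add: orthogonal_def inner_diff_right inner_commute)
  then have "(norm (p x + (x - p x - m)))\<^sup>2 = (norm (p x))\<^sup>2 + (norm (x - p x - m))\<^sup>2"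
    by (rule norm_add_Pythagorean)
  then have "(norm (x - m))\<^sup>2 = (norm (p x))\<^sup>2 + (norm (x - p x - m))\<^sup>2" by simp
  then show ?thesis
    by (simp add: isotropic_density_def radial_def resid_def radius_def exp_add[symmetric]
        add_divide_distrib diff_divide_distrib)
qed

lemma resid_nonneg [simp]: "0 \<le> resid x"
  by (simp add: resid_def)

lemma radial_pos [simp]: "0 < radial r"
  by (simp add: radial_def)

lemma ennreal_radial_nonzero [simp]: "ennreal (radial r) \<noteq> 0"
  by (simp add: ennreal_eq_0_iff not_le)

lemma emeasure_radial_measure:
  assumes [measurable]: "A \<in> sets borel" "B \<in> sets borel"
  shows "emeasure (radial_measure A) B
       = (\<integral>\<^sup>+x. indicator A (shape x) * ennreal (resid x) * indicator B (radius x) \<partial>lborel)"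
proof -
  have [measurable]: "radius -` B \<in> sets borel"
    using measurable_sets[of radius borel borel B] by simp
  have "emeasure (radial_measure A) B
      = emeasure (density lborel (\<lambda>x. indicator A (shape x) * ennreal (resid x))) (radius -` B)"
    unfolding radial_measure_def by (subst emeasure_distr) auto
  also have "\<dots> = (\<integral>\<^sup>+x. indicator A (shape x) * ennreal (resid x) * indicator (radius -` B) x \<partial>lborel)"
    by (rule emeasure_density) auto
  finally show ?thesis by (simp add: indicator_vimage[symmetric])
qed

lemma sets_radial_measure [simp, measurable_cong]: "sets (radial_measure A) = sets borel"
  by (simp add: radial_measure_def)

lemma space_radial_measure [simp]: "space (radial_measure A) = UNIV"
  by (simp add: radial_measure_def)

text \<open>Substituting \<open>stretch r\<close> in the defining integral leaves
  \<open>shape\<close> and \<open>resid\<close> fixed and multiplies the radius by r. The constant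
  is obtained from r alone, before \<open>A\<close> and \<open>B\<close> are given.\<close>

lemma radial_measure_scaling:
  assumes r: "0 < r"
  obtains c :: real where "0 < c"
    and "\<And>A B. A \<in> sets borel \<Longrightarrow> B \<in> sets borel \<Longrightarrow>
      emeasure (radial_measure A) {t. r * t \<in> B} = ennreal c * emeasure (radial_measure A) B"
proof -
  obtain c where c: "0 < c"
    and int: "\<And>f. f \<in> borel_measurable borel \<Longrightarrow>
      (\<integral>\<^sup>+x. f (stretch r x) \<partial>lborel) = ennreal c * (\<integral>\<^sup>+x. f x \<partial>lborel)"
    using nn_integral_lborel_linear[OF linear_stretch inj_stretch[OF r]] by metis
  show thesis
  proof
    fix A :: "('a \<times> 'a) set" and B :: "real set"
    assume [measurable]: "A \<in> sets borel" "B \<in> sets borel"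
    have "emeasure (radial_measure A) {t. r * t \<in> B}
      = (\<integral>\<^sup>+x. indicator A (shape (stretch r x)) * ennreal (resid (stretch r x))
          * indicator B (radius (stretch r x)) \<partial>lborel)"
      by (subst emeasure_radial_measure)
        (use r in \<open>auto simp: shape_stretch resid_stretch radius_stretch indicator_def intro!: nn_integral_cong\<close>)
    also have "\<dots> = ennreal c * emeasure (radial_measure A) B"
      by (simp add: int[of "\<lambda>x. indicator A (shape x) * ennreal (resid x) * indicator B (radius x)"]
          emeasure_radial_measure)
    finally show "emeasure (radial_measure A) {t. r * t \<in> B} = ennreal c * emeasure (radial_measure A) B" .
  qed (fact c)
qed

text \<open>Returns from Lebesgue measure to probabilities: by \<open>density_split\<close> the
  missing density factor depends only on the radius, so it becomes an integrand over
  \<open>radial_measure\<close>.\<close>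

lemma emeasure_radius_shape:
  assumes [measurable]: "A \<in> sets borel" "B \<in> sets borel"
  shows "emeasure M {\<omega> \<in> space M. radius (X \<omega>) \<in> B \<and> shape (X \<omega>) \<in> A}
       = (\<integral>\<^sup>+t. ennreal (radial t) * indicator B t \<partial>radial_measure A)"
proof -
  have "emeasure M {\<omega> \<in> space M. radius (X \<omega>) \<in> B \<and> shape (X \<omega>) \<in> A}
      = emeasure M (X -` {x. radius x \<in> B \<and> shape x \<in> A} \<inter> space M)"
    by (rule arg_cong[of _ _ "emeasure M"]) auto
  also have "\<dots> = (\<integral>\<^sup>+x. ennreal (isotropic_density m \<sigma> x) * indicator {x. radius x \<in> B \<and> shape x \<in> A} x \<partial>lborel)"
    by (subst distributed_emeasure[OF X]) auto
  also have "\<dots> = (\<integral>\<^sup>+x. (indicator A (shape x) * ennreal (resid x)) * (ennreal (radial (radius x)) * indicator B (radius x)) \<partial>lborel)"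
    by (intro nn_integral_cong)
      (auto simp: density_split indicator_def ennreal_mult'' mult.commute)
  also have "\<dots> = (\<integral>\<^sup>+t. ennreal (radial t) * indicator B t \<partial>radial_measure A)"
    unfolding radial_measure_def
    by (simp add: nn_integral_distr nn_integral_density)
  finally show ?thesis .
qed

text \<open>A vector with \<open>p x = 0\<close> is orthogonal to the range of \<open>p\<close>, so
  the kernel lies in the hyperplane orthogonal to one nonzero \<open>p z\<close>.\<close>

lemma null_kernel: "emeasure lborel {x. p x = 0} = 0"
proof -
  obtain z where z: "p z \<noteq> 0" using nontrivial by blast
  have "negligible {x. p z \<bullet> x = 0}"
    by (rule negligible_hyperplane) (use z in simp)
  moreover have "{x. p x = 0} \<subseteq> {x. p z \<bullet> x = 0}"
  proof
    fix x assume "x \<in> {x. p x = 0}"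
    then show "x \<in> {x. p z \<bullet> x = 0}" using orth[of x z] by (simp add: inner_commute)
  qed
  ultimately have "negligible {x. p x = 0}" by (rule negligible_subset)
  then show ?thesis
    by (simp add: negligible_iff_null_sets null_sets_def emeasure_completion)
qed

text \<open>Radii are nonnegative and radius 0 occurs only on the null kernel. This covers the half
  lines that scaling by a positive factor cannot reach from \<open>{..1}\<close>.\<close>

lemma radial_measure_nonpos:
  assumes A [measurable]: "A \<in> sets borel" and "r \<le> 0"
  shows "emeasure (radial_measure A) {..r} = 0"
proof -
  have "AE x in lborel. p x \<noteq> 0"
    by (rule AE_I[of _ _ "{x. p x = 0}"]) (auto simp: null_kernel)
  then have "AE x in lborel. indicator A (shape x) * ennreal (resid x) * indicator {..r} (radius x) = 0"
    by eventually_elim (use \<open>r \<le> 0\<close> in \<open>auto simp: indicator_def radius_def\<close>, meson norm_le_zero_iff order_trans)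
  then show ?thesis
    by (subst emeasure_radial_measure) (auto simp: nn_integral_0_iff_AE)
qed

text \<open>For radius at most r > 0 the factor \<open>radial\<close> is at least
  \<open>radial r\<close>, so \<open>radial r\<close> times the mass is bounded by the integral of
  the Gaussian density, which is 1.\<close>

lemma radial_measure_finite:
  assumes A [measurable]: "A \<in> sets borel"
  shows "emeasure (radial_measure A) {..r} < \<infinity>"
proof (cases "r \<le> 0")
  case True
  then show ?thesis using radial_measure_nonpos[OF A] by simp
next
  case False
  have "ennreal (radial r) * emeasure (radial_measure A) {..r}
      = (\<integral>\<^sup>+x. ennreal (radial r) * (indicator A (shape x) * ennreal (resid x) * indicator {..r} (radius x)) \<partial>lborel)"
    by (subst emeasure_radial_measure) (auto simp: nn_integral_cmult)
  also have "\<dots> \<le> (\<integral>\<^sup>+x. ennreal (isotropic_density m \<sigma> x) \<partial>lborel)"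
  proof (rule nn_integral_mono)
    fix x :: 'a
    have "radial r \<le> radial (radius x)" if "radius x \<le> r"
      using that \<sigma> by (auto simp: radial_def radius_def intro!: divide_right_mono power_mono)
    then have "radial r * resid x \<le> isotropic_density m \<sigma> x" if "radius x \<le> r"
      using that unfolding density_split by (intro mult_right_mono) auto
    then show "ennreal (radial r) * (indicator A (shape x) * ennreal (resid x) * indicator {..r} (radius x))
        \<le> ennreal (isotropic_density m \<sigma> x)"
      by (auto simp: indicator_def ennreal_mult'[symmetric] less_imp_le ennreal_leI)
  qed
  also have "\<dots> = emeasure M (X -` UNIV \<inter> space M)"
    by (subst distributed_emeasure[OF X]) auto
  also have "\<dots> < \<infinity>" by (simp add: emeasure_space_1)
  finally have "ennreal (radial r) * emeasure (radial_measure A) {..r} < \<infinity>" .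
  then show ?thesis
    by (auto simp: ennreal_mult_less_top)
qed

text \<open>
  The factor of \<open>radial_measure_scaling\<close> does not depend on the set of shapes, so it never has to be
  computed.
\<close>

lemma radial_measure_proportional:
  assumes A [measurable]: "A \<in> sets borel"
  shows "scale_measure (emeasure (radial_measure UNIV) {..1}) (radial_measure A)
       = scale_measure (emeasure (radial_measure A) {..1}) (radial_measure UNIV)"
    (is "scale_measure ?a _ = scale_measure ?b _")
proof (rule measure_eqI_generator_eq[where E="range atMost" and \<Omega>=UNIV and A="\<lambda>n. {..real n}"])
  show "Int_stable (range (atMost :: real \<Rightarrow> _))"
    by (auto simp: Int_stable_def intro!: image_eqI[of _ _ "min _ _"])
  have "sets (borel :: real measure) = sigma_sets UNIV (range atMost)"
    by (subst borel_eq_atMost) (simp add: sets_measure_of)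
  then show "sets (scale_measure ?a (radial_measure A)) = sigma_sets UNIV (range atMost)"
    "sets (scale_measure ?b (radial_measure UNIV)) = sigma_sets UNIV (range atMost)" by simp_all
  show "(\<Union>n. {..real n}) = UNIV" using real_arch_simple by auto
  show "emeasure (scale_measure ?a (radial_measure A)) {..real n} \<noteq> \<infinity>" for n
    using radial_measure_finite[of UNIV 1] radial_measure_finite[OF A, of n]
    by (simp add: ennreal_mult_eq_top_iff less_top)
  fix S :: "real set" assume "S \<in> range atMost"
  then obtain r where S: "S = {..r}" by auto
  show "emeasure (scale_measure ?a (radial_measure A)) S = emeasure (scale_measure ?b (radial_measure UNIV)) S"
  proof (cases "r \<le> 0")
    case True
    then show ?thesis using radial_measure_nonpos[OF A] radial_measure_nonpos[of UNIV] by (simp add: S)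
  next
    case False
    then have r: "0 < r" by simp
    obtain c where "0 < c" and c: "\<And>A B. A \<in> sets borel \<Longrightarrow> B \<in> sets borel \<Longrightarrow>
      emeasure (radial_measure A) {t. r * t \<in> B} = ennreal c * emeasure (radial_measure A) B"
      using radial_measure_scaling[OF r] by metis
    \<comment> \<open>Scaling thus expresses both masses of \<open>{..1}\<close> as the same
      multiple of the corresponding masses of \<open>{..r}\<close>, and cross-multiplying removes
      that multiple.\<close>
    have "{t. r * t \<in> {..r}} = {..1}" using r by (auto simp: mult_le_cancel_left1)
    then have "?a = ennreal c * emeasure (radial_measure UNIV) {..r}"
      "?b = ennreal c * emeasure (radial_measure A) {..r}"
      using c[of UNIV "{..r}"] c[OF A, of "{..r}"] by simp_all
    then show ?thesis by (simp add: S mult_ac)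
  qed
qed auto

text \<open>Otherwise scaling would make every half line null, hence the whole measure zero, against
  total probability 1. This permits cancelling the mass in the proof of independence.\<close>

lemma radial_measure_UNIV_pos: "emeasure (radial_measure UNIV) {..1} \<noteq> 0"
proof
  assume *: "emeasure (radial_measure UNIV) {..1} = 0"
  have "emeasure (radial_measure UNIV) {..r} = 0" for r
  proof (cases "r \<le> 0")
    case False
    then have r: "0 < r" by simp
    obtain c where "0 < c" and c: "\<And>A B. A \<in> sets borel \<Longrightarrow> B \<in> sets borel \<Longrightarrow>
      emeasure (radial_measure A) {t. r * t \<in> B} = ennreal c * emeasure (radial_measure A) B"
      using radial_measure_scaling[OF r] by metis
    have "{t. r * t \<in> {..r}} = {..1}" using r by (auto simp: mult_le_cancel_left1)
    then have "ennreal c * emeasure (radial_measure UNIV) {..r} = 0"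
      using c[of UNIV "{..r}"] * by simp
    then show ?thesis using \<open>0 < c\<close> by simp
  qed (simp add: radial_measure_nonpos)
  then have "(\<Union>n. {..real n}) \<in> null_sets (radial_measure UNIV)"
    by (intro null_sets_UN) (auto simp: null_sets_def)
  moreover have "(\<Union>n. {..real n}) = UNIV" using real_arch_simple by auto
  ultimately have null: "UNIV \<in> null_sets (radial_measure UNIV)" by simp
  have "emeasure M {\<omega> \<in> space M. radius (X \<omega>) \<in> UNIV \<and> shape (X \<omega>) \<in> UNIV} = 0"
    unfolding emeasure_radius_shape[OF sets.top sets.top, simplified]
    using null by (subst emeasure_radius_shape) (auto simp: nn_integral_0_iff_AE intro: AE_I')
  then show False by (simp add: emeasure_space_1)
qed

text \<open>Integrating \<open>radial\<close> over the proportional measures gives ?a * Q A B = ?b *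
  Q UNIV B. Taking B = UNIV identifies ?b as ?a * Q A UNIV, and ?a, nonzero and finite,
  cancels.\<close>

lemma radius_shape_indep:
  assumes A [measurable]: "A \<in> sets borel" and B [measurable]: "B \<in> sets borel"
  shows "emeasure M {\<omega> \<in> space M. radius (X \<omega>) \<in> B \<and> shape (X \<omega>) \<in> A}
    = emeasure M {\<omega> \<in> space M. radius (X \<omega>) \<in> B} * emeasure M {\<omega> \<in> space M. shape (X \<omega>) \<in> A}"
proof -
  let ?a = "emeasure (radial_measure UNIV) {..1}" and ?b = "emeasure (radial_measure A) {..1}"
  define Q where "Q A B = emeasure M {\<omega> \<in> space M. radius (X \<omega>) \<in> B \<and> shape (X \<omega>) \<in> A}" for A B
  have *: "?a * Q A B' = ?b * Q UNIV B'" if [measurable]: "B' \<in> sets borel" for B'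
  proof -
    have "?a * Q A B' = (\<integral>\<^sup>+t. ennreal (radial t) * indicator B' t \<partial>scale_measure ?a (radial_measure A))"
      unfolding Q_def by (subst emeasure_radius_shape) (auto simp: nn_integral_scale_measure)
    also have "\<dots> = ?b * Q UNIV B'"
      unfolding Q_def radial_measure_proportional[OF A]
      by (subst emeasure_radius_shape) (auto simp: nn_integral_scale_measure)
    finally show ?thesis .
  qed
  have one: "Q UNIV UNIV = 1" by (simp add: Q_def emeasure_space_1)
  have "?a * Q A B = ?a * (Q UNIV B * Q A UNIV)"
  proof -
    have b: "?b = ?a * Q A UNIV" using *[of UNIV] one by simp
    show ?thesis unfolding *[OF B] b by (simp add: mult_ac)
  qed
  moreover have a_fin: "?a \<noteq> top" using radial_measure_finite[of UNIV 1] by auto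
  ultimately have "Q A B = Q UNIV B * Q A UNIV"
    using radial_measure_UNIV_pos a_fin unfolding ennreal_mult_cancel_left by blast
  then show ?thesis by (simp add: Q_def)
qed

lemma distr_radius_shape:
  "distr M (borel \<Otimes>\<^sub>M borel) (\<lambda>\<omega>. (radius (X \<omega>) / \<sigma>, shape (X \<omega>)))
     = distr M borel (\<lambda>\<omega>. radius (X \<omega>) / \<sigma>) \<Otimes>\<^sub>M distr M borel (\<lambda>\<omega>. shape (X \<omega>))"
proof (rule pair_measure_eqI[symmetric])
  interpret D1: prob_space "distr M borel (\<lambda>\<omega>. radius (X \<omega>) / \<sigma>)" by (rule prob_space_distr) simp
  interpret D2: prob_space "distr M borel (\<lambda>\<omega>. shape (X \<omega>))" by (rule prob_space_distr) simp
  show "sigma_finite_measure (distr M borel (\<lambda>\<omega>. radius (X \<omega>) / \<sigma>))"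
    "sigma_finite_measure (distr M borel (\<lambda>\<omega>. shape (X \<omega>)))" by unfold_locales
  fix B :: "real set" and A :: "('a \<times> 'a) set"
  assume "B \<in> sets (distr M borel (\<lambda>\<omega>. radius (X \<omega>) / \<sigma>))" "A \<in> sets (distr M borel (\<lambda>\<omega>. shape (X \<omega>)))"
  then have [measurable]: "B \<in> sets borel" "A \<in> sets borel" by simp_all
  have [measurable]: "{t. t / \<sigma> \<in> B} \<in> sets borel"
    using measurable_sets[of "\<lambda>t. t / \<sigma>" borel borel B] by (simp add: vimage_def)
  show "emeasure (distr M borel (\<lambda>\<omega>. radius (X \<omega>) / \<sigma>)) B * emeasure (distr M borel (\<lambda>\<omega>. shape (X \<omega>))) A
    = emeasure (distr M (borel \<Otimes>\<^sub>M borel) (\<lambda>\<omega>. (radius (X \<omega>) / \<sigma>, shape (X \<omega>)))) (B \<times> A)"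
    using radius_shape_indep[of A "{t. t / \<sigma> \<in> B}"]
    by (simp add: emeasure_distr vimage_def Int_def conj_commute)
qed simp

text \<open>By scaling, an atom at one positive radius would produce atoms at all of them.\<close>

lemma radius_no_atoms: "measure (distr M borel (\<lambda>\<omega>. radius (X \<omega>) / \<sigma>)) {t} = 0"
proof (rule ccontr)
  let ?D = "distr M borel (\<lambda>\<omega>. radius (X \<omega>) / \<sigma>)"
  interpret D: prob_space ?D by (rule prob_space_distr) simp
  interpret D: finite_borel_measure ?D by standard simp_all
  \<comment> \<open>On a single point the factor \<open>radial\<close> is a positive constant, so
    atoms of the scaled radius correspond to atoms of \<open>radial_measure UNIV\<close>, to which
    scaling applies.\<close>
  have iff: "0 < measure ?D {s} \<longleftrightarrow> emeasure (radial_measure UNIV) {\<sigma> * s} \<noteq> 0" for s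
  proof -
    have "emeasure ?D {s} = emeasure M {\<omega> \<in> space M. radius (X \<omega>) \<in> {\<sigma> * s} \<and> shape (X \<omega>) \<in> UNIV}"
      using \<sigma> by (subst emeasure_distr) (auto intro!: arg_cong[of _ _ "emeasure M"] simp: field_simps)
    also have "\<dots> = (\<integral>\<^sup>+u. ennreal (radial u) * indicator {\<sigma> * s} u \<partial>radial_measure UNIV)"
      by (rule emeasure_radius_shape) auto
    also have "\<dots> = (\<integral>\<^sup>+u. ennreal (radial (\<sigma> * s)) * indicator {\<sigma> * s} u \<partial>radial_measure UNIV)"
      by (intro nn_integral_cong) (auto simp: indicator_def)
    also have "\<dots> = ennreal (radial (\<sigma> * s)) * emeasure (radial_measure UNIV) {\<sigma> * s}"
      by (simp add: nn_integral_cmult)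
    finally show ?thesis
      by (auto simp: zero_less_measure_iff D.emeasure_eq_measure)
  qed
  assume "measure ?D {t} \<noteq> 0"
  then have pos: "emeasure (radial_measure UNIV) {\<sigma> * t} \<noteq> 0"
    using iff[of t] by (simp add: zero_less_measure_iff)
  have "0 < t"
  proof (rule ccontr)
    assume "\<not> 0 < t"
    then have "\<sigma> * t \<le> 0" using \<sigma> by (simp add: mult_le_0_iff)
    then have "emeasure (radial_measure UNIV) {..\<sigma> * t} = 0" by (simp add: radial_measure_nonpos)
    moreover have "emeasure (radial_measure UNIV) {\<sigma> * t} \<le> emeasure (radial_measure UNIV) {..\<sigma> * t}"
      by (rule emeasure_mono) auto
    ultimately show False using pos by simp
  qed
  have "0 < measure ?D {s}" if "0 < s" for s
  proof -
    \<comment> \<open>The ratio is chosen so that multiplication by it carries \<sigma> s to the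
      given atom \<sigma> t. Every positive s becomes an atom, while a finite measure has only
      countably many.\<close>
    have r: "0 < t / s" using \<open>0 < t\<close> that by simp
    obtain c where "0 < c" and c: "\<And>A B. A \<in> sets borel \<Longrightarrow> B \<in> sets borel \<Longrightarrow>
      emeasure (radial_measure A) {u. t / s * u \<in> B} = ennreal c * emeasure (radial_measure A) B"
      using radial_measure_scaling[OF r] by metis
    have "{u. t / s * u \<in> {\<sigma> * t}} = {\<sigma> * s}" using \<open>0 < t\<close> that by (auto simp: field_simps)
    then have "emeasure (radial_measure UNIV) {\<sigma> * s} \<noteq> 0"
      using c[of UNIV "{\<sigma> * t}"] pos \<open>0 < c\<close> by simp
    then show ?thesis by (simp add: iff)
  qed
  then have "{0<..} \<subseteq> {s. 0 < measure ?D {s}}" by auto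
  then have "countable {0::real<..}" using D.countable_atoms countable_subset by blast
  moreover have "{0<..<1} \<subseteq> {0::real<..}" by auto
  ultimately have "countable {0<..<1::real}" using countable_subset by blast
  then show False using uncountable_open_interval[of "0::real" 1] by simp
qed

lemma AE_p_nonzero: "AE \<omega> in M. p (X \<omega>) \<noteq> 0"
proof -
  let ?D = "distr M borel (\<lambda>\<omega>. radius (X \<omega>) / \<sigma>)"
  have "measure ?D {0} = measure M {\<omega> \<in> space M. p (X \<omega>) = 0}"
    using \<sigma> by (subst measure_distr) (auto intro!: arg_cong[of _ _ "measure M"] simp: radius_def)
  then have "measure M {\<omega> \<in> space M. p (X \<omega>) = 0} = 0" by (simp add: radius_no_atoms)
  then show ?thesis
    by (intro AE_I[of _ _ "{\<omega> \<in> space M. p (X \<omega>) = 0}"]) (auto simp: emeasure_eq_measure)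
qed

end

subsection \<open>Conditioning one of two independent variables on a joint event\<close>

text \<open>A nonzero difference at x stays nonzero on an interval to the right of x, which contains
  a rational. Serves to reduce equality of CDFs to countably many almost sure equalities.\<close>

lemma right_continuous_eq_on_Rats:
  fixes f g :: "real \<Rightarrow> real"
  assumes f: "\<And>x. continuous (at_right x) f" and g: "\<And>x. continuous (at_right x) g"
    and eq: "\<And>q. q \<in> \<rat> \<Longrightarrow> f q = g q"
  shows "f = g"
proof
  fix x
  have "((\<lambda>y. f y - g y) \<longlongrightarrow> f x - g x) (at_right x)"
    using f[of x] g[of x] unfolding continuous_within by (rule tendsto_diff)
  show "f x = g x"
  proof (rule ccontr)
    assume "f x \<noteq> g x"
    then have "eventually (\<lambda>y. f y - g y \<noteq> 0) (at_right x)"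
      using \<open>(_ \<longlongrightarrow> f x - g x) (at_right x)\<close> by (intro tendsto_imp_eventually_ne) auto
    then obtain b where "b > x" and b: "\<And>y. x < y \<Longrightarrow> y < b \<Longrightarrow> f y - g y \<noteq> 0"
      unfolding eventually_at_right_field by blast
    obtain q where "q \<in> \<rat>" "x < q" "q < b"
      using Rats_dense_in_real[OF \<open>x < b\<close>] by blast
    then show False using b[of q] eq[of q] by simp
  qed
qed

text \<open>Without atoms the CDF is continuous, so its superlevel set at 1 - \<alpha> is a closed
  half line starting at a point \<open>t0\<close> where the CDF equals 1 - \<alpha>. Taking the
  infimum copes with flat stretches of the CDF.\<close>

lemma (in real_distribution) prob_integral_transform:
  assumes atomless: "\<And>x. measure M {x} = 0" and \<alpha>: "0 < \<alpha>" "\<alpha> < 1"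
  shows "measure M {t. 1 - cdf M t \<le> \<alpha>} = \<alpha>"
proof -
  have cont: "isCont (cdf M) x" for x using atomless by (simp add: isCont_cdf)
  define A where "A = {t. 1 - \<alpha> \<le> cdf M t}"
  \<comment> \<open>The limits at both ends make \<open>A\<close> bounded below and nonempty, so its
    infimum exists and, as \<open>A\<close> is closed, belongs to it.\<close>
  have "eventually (\<lambda>t. cdf M t < 1 - \<alpha>) at_bot"
    using \<alpha> by (intro order_tendstoD(2)[OF cdf_lim_at_bot]) simp
  then obtain l where l: "cdf M l < 1 - \<alpha>"
    by (auto simp: eventually_at_bot_linorder)
  have "eventually (\<lambda>t. 1 - \<alpha> < cdf M t) at_top"
    using \<alpha> by (intro order_tendstoD(1)[OF cdf_lim_at_top_prob]) simp
  then obtain u where u: "1 - \<alpha> < cdf M u"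
    by (auto simp: eventually_at_top_linorder)
  have "u \<in> A" using u by (simp add: A_def)
  have lower: "l \<le> t" if "t \<in> A" for t
    using that l cdf_nondecreasing[of t l] by (force simp: A_def)
  have "closed A"
    unfolding A_def using cont by (intro closed_Collect_le) (auto simp: continuous_on_eq_continuous_at)
  define t0 where "t0 = Inf A"
  have bdd: "bdd_below A" using lower by (rule bdd_belowI)
  have "t0 \<in> A"
    unfolding t0_def using \<open>u \<in> A\<close> \<open>closed A\<close> bdd by (intro closed_contains_Inf) auto
  have A_eq: "A = {t0..}"
  proof
    show "A \<subseteq> {t0..}" using bdd by (auto simp: t0_def intro: cInf_lower)
    show "{t0..} \<subseteq> A" using \<open>t0 \<in> A\<close> cdf_nondecreasing by (force simp: A_def)
  qed
  have "cdf M t0 \<le> 1 - \<alpha>"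
  proof (rule tendsto_upperbound)
    show "(cdf M \<longlongrightarrow> cdf M t0) (at_left t0)"
      using cont[of t0] unfolding isCont_def by (rule tendsto_within_subset) simp
    have "cdf M t \<le> 1 - \<alpha>" if "t < t0" for t
    proof -
      have "t \<notin> A" using that A_eq by simp
      then show ?thesis by (simp add: A_def)
    qed
    then show "eventually (\<lambda>t. cdf M t \<le> 1 - \<alpha>) (at_left t0)"
      unfolding eventually_at_left_field by (intro exI[of _ "t0 - 1"]) simp
  qed simp
  then have t0: "cdf M t0 = 1 - \<alpha>" using \<open>t0 \<in> A\<close> by (simp add: A_def)
  have "measure M A = measure M {t0} + measure M {t0<..}"
    unfolding A_eq by (subst finite_measure_Union[symmetric]) (auto intro!: arg_cong[of _ _ "measure M"])
  also have "\<dots> = 1 - cdf M t0"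
    using prob_compl[of "{..t0}"] by (simp add: atomless cdf_def Compl_eq_Diff_UNIV[symmetric])
  finally show ?thesis using t0 by (simp add: A_def algebra_simps)
qed

text \<open>Both the kernel and the half line vary with \<omega>; the half lines form the jointly
  measurable region t \<le> T(\<omega>).\<close>

lemma measurable_cdf_kernel:
  assumes \<kappa>: "\<kappa> \<in> borel \<rightarrow>\<^sub>M prob_algebra borel"
    and [measurable]: "T \<in> borel_measurable M" "Z \<in> borel_measurable M"
  shows "(\<lambda>\<omega>. cdf (\<kappa> (Z \<omega>)) (T \<omega>)) \<in> borel_measurable M"
proof -
  have "(\<lambda>\<omega>. measure (\<kappa> (Z \<omega>)) {..T \<omega>}) \<in> borel_measurable M"
  proof (rule measure_measurable_prob_algebra2)
    have "Sigma (space M) (\<lambda>\<omega>. {..T \<omega>}) = {x \<in> space (M \<Otimes>\<^sub>M borel). snd x \<le> T (fst x)}"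
      by (auto simp: space_pair_measure)
    also have "\<dots> \<in> sets (M \<Otimes>\<^sub>M borel)" by measurable
    finally show "Sigma (space M) (\<lambda>\<omega>. {..T \<omega>}) \<in> sets (M \<Otimes>\<^sub>M borel)" .
    show "(\<lambda>\<omega>. \<kappa> (Z \<omega>)) \<in> M \<rightarrow>\<^sub>M prob_algebra borel"
      using \<kappa> by measurable
  qed
  then show ?thesis by (simp add: cdf_def)
qed

text \<open>Independence is stated as a product law, ready for Fubini. \<open>E\<close> represents
  the conditioning event in the (T, Z) plane up to a null set.\<close>

locale truncated_independent = prob_space M for M :: "'w measure" +
  fixes T :: "'w \<Rightarrow> real" and Z :: "'w \<Rightarrow> 'z::second_countable_topology"
    and E :: "(real \<times> 'z) set" and ev :: "'w \<Rightarrow> bool"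
  assumes T [measurable]: "T \<in> borel_measurable M"
    and Z [measurable]: "Z \<in> borel_measurable M"
    and E [measurable]: "E \<in> sets (borel \<Otimes>\<^sub>M borel)"
    and ev [measurable]: "{\<omega> \<in> space M. ev \<omega>} \<in> events"
    and indep: "distr M (borel \<Otimes>\<^sub>M borel) (\<lambda>\<omega>. (T \<omega>, Z \<omega>)) = distr M borel T \<Otimes>\<^sub>M distr M borel Z"
    and ev_iff: "AE \<omega> in M. ev \<omega> \<longleftrightarrow> (T \<omega>, Z \<omega>) \<in> E"
    and ev_pos: "0 < prob {\<omega> \<in> space M. ev \<omega>}"
begin

definition law :: "real measure" where "law = distr M borel T"

definition slice :: "'z \<Rightarrow> real set" where "slice z = {t. (t, z) \<in> E}"

definition M_ev :: "'w measure" where "M_ev = uniform_measure M {\<omega> \<in> space M. ev \<omega>}"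

text \<open>The default on null slices keeps every value a probability measure, so that the kernel
  maps into \<open>prob_algebra\<close> everywhere; such slices have probability zero under
  \<open>M_ev\<close>.\<close>

definition kernel :: "'z \<Rightarrow> real measure" where
  "kernel z = (if measure law (slice z) = 0 then law else uniform_measure law (slice z))"

sublocale law: real_distribution law
  unfolding law_def using T by (rule real_distribution_distr)

sublocale law_pair: pair_sigma_finite law "distr M borel Z"
proof -
  interpret D: prob_space "distr M borel Z" by (rule prob_space_distr) simp
  show "pair_sigma_finite law (distr M borel Z)" ..
qed

lemma space_M_ev [simp]: "space M_ev = space M" and sets_M_ev [simp, measurable_cong]: "sets M_ev = events"
  by (simp_all add: M_ev_def)

lemma prob_space_M_ev: "prob_space M_ev"
  unfolding M_ev_def using ev_pos by (intro prob_space_uniform_measure) (auto simp: emeasure_eq_measure)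

sublocale M_ev: prob_space M_ev by (rule prob_space_M_ev)

lemma slice_sets [measurable]: "slice z \<in> sets borel"
proof -
  have "(\<lambda>t. (t, z)) -` E \<inter> space borel \<in> sets borel"
    by (rule measurable_sets[OF _ E]) simp
  then show ?thesis by (simp add: slice_def vimage_def)
qed

lemma nn_integral_ev:
  assumes [measurable]: "F \<in> borel_measurable (borel \<Otimes>\<^sub>M borel)"
  shows "(\<integral>\<^sup>+\<omega>. F (T \<omega>, Z \<omega>) * indicator {\<omega> \<in> space M. ev \<omega>} \<omega> \<partial>M)
       = (\<integral>\<^sup>+z. (\<integral>\<^sup>+t. F (t, z) * indicator (slice z) t \<partial>law) \<partial>distr M borel Z)"
proof -
  have "(\<integral>\<^sup>+\<omega>. F (T \<omega>, Z \<omega>) * indicator {\<omega> \<in> space M. ev \<omega>} \<omega> \<partial>M)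
      = (\<integral>\<^sup>+\<omega>. F (T \<omega>, Z \<omega>) * indicator E (T \<omega>, Z \<omega>) \<partial>M)"
  proof (rule nn_integral_cong_AE)
    show "AE \<omega> in M. F (T \<omega>, Z \<omega>) * indicator {\<omega> \<in> space M. ev \<omega>} \<omega>
        = F (T \<omega>, Z \<omega>) * indicator E (T \<omega>, Z \<omega>)"
      using ev_iff AE_space by eventually_elim (auto simp: indicator_def)
  qed
  also have "\<dots> = (\<integral>\<^sup>+x. F x * indicator E x \<partial>(law \<Otimes>\<^sub>M distr M borel Z))"
    unfolding law_def indep[symmetric] by (subst nn_integral_distr) auto
  also have "\<dots> = (\<integral>\<^sup>+z. (\<integral>\<^sup>+t. F (t, z) * indicator E (t, z) \<partial>law) \<partial>distr M borel Z)"
    by (subst law_pair.nn_integral_snd[symmetric]) (auto simp: law_def)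
  finally show ?thesis by (simp add: slice_def indicator_def)
qed

lemma measurable_law_slice:
  assumes [measurable]: "B \<in> sets borel"
  shows "(\<lambda>z. emeasure law (slice z \<inter> B)) \<in> borel_measurable borel"
proof -
  have "E \<inter> (B \<times> space borel) \<in> sets (law \<Otimes>\<^sub>M distr M borel Z)"
    by (simp add: law_def)
  then have *: "(\<lambda>z. emeasure law ((\<lambda>t. (t, z)) -` (E \<inter> (B \<times> space borel)))) \<in> borel_measurable (distr M borel Z)"
    by (rule law_pair.measurable_emeasure_Pair2)
  have "(\<lambda>t. (t, z)) -` (E \<inter> (B \<times> space borel)) = slice z \<inter> B" for z
    by (auto simp: slice_def)
  then show ?thesis using * by (simp only: measurable_distr_eq1)
qed

lemma emeasure_kernel:
  assumes [measurable]: "B \<in> sets borel"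
  shows "emeasure (kernel z) B = (if emeasure law (slice z) = 0 then emeasure law B
    else emeasure law (slice z \<inter> B) / emeasure law (slice z))"
  by (auto simp: kernel_def law.emeasure_eq_measure)

lemma sets_kernel [simp]: "sets (kernel z) = sets borel"
  by (simp add: kernel_def)

lemma real_distribution_kernel: "real_distribution (kernel z)"
proof -
  have "prob_space (kernel z)"
    unfolding kernel_def
    by (auto intro!: prob_space_uniform_measure law.prob_space_axioms simp: law.emeasure_eq_measure)
  then show ?thesis
    by (simp add: real_distribution_def real_distribution_axioms_def)
qed

lemma kernel_measurable [measurable]: "kernel \<in> borel \<rightarrow>\<^sub>M prob_algebra borel"
proof (rule measurable_prob_algebraI)
  show "prob_space (kernel z)" for z
    using real_distribution_kernel by (simp add: real_distribution_def)
  then show "kernel \<in> borel \<rightarrow>\<^sub>M subprob_algebra borel"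
  proof (intro measurable_subprob_algebra)
    fix B :: "real set" assume [measurable]: "B \<in> sets borel"
    note measurable_law_slice[measurable]
    have [measurable]: "(\<lambda>z. emeasure law (slice z)) \<in> borel_measurable borel"
      using measurable_law_slice[of UNIV] by simp
    show "(\<lambda>z. emeasure (kernel z) B) \<in> borel_measurable borel"
      by (subst emeasure_kernel) measurable
  qed (auto intro: prob_space_imp_subprob_space)
qed

text \<open>On a null slice both sides vanish, whatever the default kernel is; elsewhere the
  normalising mass cancels.\<close>

lemma nn_integral_kernel:
  assumes [measurable]: "f \<in> borel_measurable borel"
  shows "(\<integral>\<^sup>+t. f t * indicator (slice z) t \<partial>law) = (\<integral>\<^sup>+t. f t \<partial>kernel z) * emeasure law (slice z)"
proof (cases "measure law (slice z) = 0")
  case True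
  then have null: "emeasure law (slice z) = 0" by (simp add: law.emeasure_eq_measure)
  then have "AE t in law. t \<notin> slice z"
    by (intro AE_I[of _ _ "slice z"]) auto
  then have "(\<integral>\<^sup>+t. f t * indicator (slice z) t \<partial>law) = 0"
    by (subst nn_integral_0_iff_AE) auto
  then show ?thesis using null by simp
next
  case False
  then have "emeasure law (slice z) / emeasure law (slice z) = 1"
    by (intro ennreal_divide_self) (simp_all add: law.emeasure_eq_measure)
  then show ?thesis
    using False by (simp add: kernel_def nn_integral_uniform_measure ennreal_divide_times)
qed

text \<open>For fixed z, integrating F over the slice gives \<open>H z\<close> times the mass of the
  slice. Integrating the constant \<open>H z\<close> over the slice gives the same, so F(T, Z) and
  H(Z) have equal integrals on the event.\<close>

lemma disintegration:
  assumes F [measurable]: "F \<in> borel_measurable (borel \<Otimes>\<^sub>M borel)"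
  shows "(\<integral>\<^sup>+\<omega>. F (T \<omega>, Z \<omega>) \<partial>M_ev) = (\<integral>\<^sup>+\<omega>. (\<integral>\<^sup>+t. F (t, Z \<omega>) \<partial>kernel (Z \<omega>)) \<partial>M_ev)"
proof -
  define H where "H z = (\<integral>\<^sup>+t. F (t, z) \<partial>kernel z)" for z
  have [measurable]: "H \<in> borel_measurable borel"
    unfolding H_def
  proof (rule nn_integral_measurable_subprob_algebra2)
    show "kernel \<in> borel \<rightarrow>\<^sub>M subprob_algebra borel"
      by (rule measurable_prob_algebraD) measurable
  qed measurable
  have "(\<integral>\<^sup>+\<omega>. F (T \<omega>, Z \<omega>) * indicator {\<omega> \<in> space M. ev \<omega>} \<omega> \<partial>M)
      = (\<integral>\<^sup>+z. (\<integral>\<^sup>+t. H z * indicator (slice z) t \<partial>law) \<partial>distr M borel Z)"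
    by (subst nn_integral_ev) (simp_all add: nn_integral_kernel H_def nn_integral_cmult)
  also have "\<dots> = (\<integral>\<^sup>+\<omega>. H (Z \<omega>) * indicator {\<omega> \<in> space M. ev \<omega>} \<omega> \<partial>M)"
    using nn_integral_ev[of "\<lambda>x. H (snd x)"] by simp
  finally show ?thesis
    unfolding M_ev_def H_def[symmetric] by (simp add: nn_integral_uniform_measure)
qed

text \<open>The event restricted to Z in \<open>N\<close> has as its probability an integral of
  slice masses, and these are zero on \<open>N\<close>.\<close>

lemma AE_slice_pos: "AE \<omega> in M_ev. measure law (slice (Z \<omega>)) \<noteq> 0"
proof -
  have [measurable]: "(\<lambda>z. emeasure law (slice z)) \<in> borel_measurable borel"
    using measurable_law_slice[of UNIV] by simp
  define N where "N = {z. emeasure law (slice z) = 0}"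
  have [measurable]: "N \<in> sets borel"
    unfolding N_def by measurable
  have "(\<integral>\<^sup>+\<omega>. indicator N (Z \<omega>) * indicator {\<omega> \<in> space M. ev \<omega>} \<omega> \<partial>M)
     = (\<integral>\<^sup>+z. (\<integral>\<^sup>+t. indicator N z * indicator (slice z) t \<partial>law) \<partial>distr M borel Z)"
    using nn_integral_ev[of "\<lambda>x. indicator N (snd x)"] by simp
  also have "\<dots> = 0"
  proof -
    have "(\<integral>\<^sup>+t. indicator N z * indicator (slice z) t \<partial>law) = 0" for z
      by (subst nn_integral_cmult) (auto simp: N_def indicator_def)
    then show ?thesis by simp
  qed
  finally have "(\<integral>\<^sup>+\<omega>. indicator N (Z \<omega>) \<partial>M_ev) = 0"
    unfolding M_ev_def by (subst nn_integral_uniform_measure) auto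
  then have "AE \<omega> in M_ev. indicator N (Z \<omega>) = (0 :: ennreal)"
    by (subst (asm) nn_integral_0_iff_AE) auto
  then show ?thesis
    by eventually_elim (auto simp: N_def law.emeasure_eq_measure)
qed

lemma cdf_kernel:
  assumes "measure law (slice z) \<noteq> 0"
  shows "cdf (kernel z) = truncated_cdf law (slice z)"
  using assms by (auto simp: fun_eq_iff cdf_def truncated_cdf_def kernel_def law.emeasure_eq_measure Int_commute
      intro!: measure_uniform_measure)

lemma subalgebra_Z: "subalgebra M_ev (vimage_algebra (space M_ev) Z borel)"
  unfolding subalgebra_def by (simp add: sets_vimage_algebra2) (use measurable_sets[OF Z] in auto)

sublocale cond: finite_measure_subalgebra M_ev "vimage_algebra (space M_ev) Z borel"
  using subalgebra_Z by unfold_locales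

text \<open>A set generated by Z is a preimage of some A', so the characterisation of conditional
  expectation is \<open>disintegration\<close> for the product of the indicators of B and A'. This
  supplies the existence claim.\<close>

lemma regular_kernel: "regular_cond_distr M_ev T Z kernel"
  unfolding regular_cond_distr_def
proof (intro conjI ballI kernel_measurable)
  let ?F = "vimage_algebra (space M_ev) Z borel"
  fix B :: "real set" assume [measurable]: "B \<in> sets borel"
  have TB [measurable]: "T -` B \<inter> space M \<in> events" by measurable
  have ind_meas [measurable]: "(indicator (T -` B) :: 'w \<Rightarrow> real) \<in> borel_measurable M_ev"
    by (subst measurable_cong[of _ _ "\<lambda>\<omega>. indicator B (T \<omega>)"]) (auto simp: indicator_def)
  have k_meas: "(\<lambda>z. measure (kernel z) B) \<in> borel_measurable borel" by measurable
  have k_nn: "measure (kernel z) B \<le> 1" for z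
    using real_distribution_kernel[of z] by (simp add: real_distribution_def prob_space.prob_le_1)
  have Z_F: "Z \<in> ?F \<rightarrow>\<^sub>M borel" by (rule measurable_vimage_algebra1) auto
  show "AE \<omega> in M_ev. real_cond_exp M_ev ?F (indicator (T -` B)) \<omega> = measure (kernel (Z \<omega>)) B"
  proof (rule cond.real_cond_exp_charact)
    show "(\<lambda>\<omega>. measure (kernel (Z \<omega>)) B) \<in> borel_measurable ?F"
      using measurable_compose[OF Z_F k_meas] .
    show "integrable M_ev (indicator (T -` B) :: 'w \<Rightarrow> real)"
      by (rule M_ev.integrable_const_bound[of _ 1]) (auto simp: indicator_def)
    show "integrable M_ev (\<lambda>\<omega>. measure (kernel (Z \<omega>)) B)"
      using k_nn by (intro M_ev.integrable_const_bound[of _ 1]) auto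
    fix A assume "A \<in> sets ?F"
    then obtain A' where A' [measurable]: "A' \<in> sets borel" and A: "A = Z -` A' \<inter> space M"
      by (auto simp: sets_vimage_algebra2)
    have "(\<integral>\<^sup>+\<omega>. indicator B (T \<omega>) * indicator A' (Z \<omega>) \<partial>M_ev)
        = (\<integral>\<^sup>+\<omega>. (\<integral>\<^sup>+t. indicator B t * indicator A' (Z \<omega>) \<partial>kernel (Z \<omega>)) \<partial>M_ev)"
      using disintegration[of "\<lambda>x. indicator B (fst x) * indicator A' (snd x)"] by simp
    also have "\<dots> = (\<integral>\<^sup>+\<omega>. ennreal (measure (kernel (Z \<omega>)) B * indicator A' (Z \<omega>)) \<partial>M_ev)"
    proof (rule nn_integral_cong)
      fix \<omega>
      interpret k: real_distribution "kernel (Z \<omega>)" by (rule real_distribution_kernel)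
      show "(\<integral>\<^sup>+t. indicator B t * indicator A' (Z \<omega>) \<partial>kernel (Z \<omega>))
        = ennreal (measure (kernel (Z \<omega>)) B * indicator A' (Z \<omega>))"
        by (simp add: nn_integral_multc k.emeasure_eq_measure ennreal_mult'' ennreal_indicator)
    qed
    finally have eq: "(\<integral>\<^sup>+\<omega>. indicator B (T \<omega>) * indicator A' (Z \<omega>) \<partial>M_ev)
      = (\<integral>\<^sup>+\<omega>. ennreal (measure (kernel (Z \<omega>)) B * indicator A' (Z \<omega>)) \<partial>M_ev)" .
    have "(\<integral>\<omega>\<in>A. indicator (T -` B) \<omega> \<partial>M_ev) = (\<integral>\<omega>. indicator B (T \<omega>) * indicator A' (Z \<omega>) \<partial>M_ev :: real)"
      unfolding set_lebesgue_integral_def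
      by (rule Bochner_Integration.integral_cong) (auto simp: A indicator_def)
    also have "\<dots> = enn2real (\<integral>\<^sup>+\<omega>. indicator B (T \<omega>) * indicator A' (Z \<omega>) \<partial>M_ev)"
      by (subst integral_eq_nn_integral) (auto simp: ennreal_mult'' ennreal_indicator)
    also have "\<dots> = (\<integral>\<omega>. measure (kernel (Z \<omega>)) B * indicator A' (Z \<omega>) \<partial>M_ev)"
      unfolding eq by (subst integral_eq_nn_integral) auto
    also have "\<dots> = (\<integral>\<omega>\<in>A. measure (kernel (Z \<omega>)) B \<partial>M_ev)"
      unfolding set_lebesgue_integral_def
      by (rule Bochner_Integration.integral_cong) (auto simp: A indicator_def)
    finally show "(\<integral>\<omega>\<in>A. indicator (T -` B) \<omega> \<partial>M_ev) = (\<integral>\<omega>\<in>A. measure (kernel (Z \<omega>)) B \<partial>M_ev)" .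
  qed
qed

text \<open>Each Borel set has its own exceptional null set. Half lines with rational endpoints
  leave one common null set, outside which right continuity determines the entire CDF.\<close>

lemma regular_cdf_unique:
  assumes \<kappa>: "regular_cond_distr M_ev T Z \<kappa>"
  shows "AE \<omega> in M_ev. cdf (\<kappa> (Z \<omega>)) = cdf (kernel (Z \<omega>))"
proof -
  have "AE \<omega> in M_ev. measure (\<kappa> (Z \<omega>)) {..q} = measure (kernel (Z \<omega>)) {..q}" for q :: real
  proof -
    have "AE \<omega> in M_ev. real_cond_exp M_ev (vimage_algebra (space M_ev) Z borel) (indicator (T -` {..q})) \<omega>
          = measure (\<kappa> (Z \<omega>)) {..q}"
      "AE \<omega> in M_ev. real_cond_exp M_ev (vimage_algebra (space M_ev) Z borel) (indicator (T -` {..q})) \<omega>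
          = measure (kernel (Z \<omega>)) {..q}"
      using \<kappa> regular_kernel unfolding regular_cond_distr_def by auto
    then show ?thesis by eventually_elim simp
  qed
  then have "AE \<omega> in M_ev. \<forall>q\<in>\<rat>. measure (\<kappa> (Z \<omega>)) {..q} = measure (kernel (Z \<omega>)) {..q}"
    by (intro AE_ball_countable[THEN iffD2] countable_rat ballI)
  then show ?thesis
  proof eventually_elim
    case (elim \<omega>)
    have "\<kappa> (Z \<omega>) \<in> space (prob_algebra borel)"
      using \<kappa> unfolding regular_cond_distr_def by (auto dest: measurable_space)
    then interpret a: real_distribution "\<kappa> (Z \<omega>)"
      by (simp add: space_prob_algebra real_distribution_def real_distribution_axioms_def)
    interpret b: real_distribution "kernel (Z \<omega>)" by (rule real_distribution_kernel)
    show ?case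
      using elim by (intro right_continuous_eq_on_Rats a.cdf_is_right_cont b.cdf_is_right_cont) (simp add: cdf_def)
  qed
qed

lemma regular_cdf_truncated:
  assumes "regular_cond_distr M_ev T Z \<kappa>"
  shows "AE \<omega> in M_ev. cdf (\<kappa> (Z \<omega>)) = truncated_cdf law (slice (Z \<omega>))"
  using regular_cdf_unique[OF assms] AE_slice_pos by eventually_elim (simp add: cdf_kernel)

text \<open>Almost surely \<open>\<kappa>\<close> may be replaced by \<open>kernel\<close>.
  Truncation creates no atoms, so for each fixed z the probability integral transform gives exactly
  \<alpha>, and disintegration averages this constant over Z.\<close>

lemma p_value_uniform:
  assumes \<kappa>: "regular_cond_distr M_ev T Z \<kappa>"
    and atomless: "\<And>t. measure law {t} = 0" and \<alpha>: "0 < \<alpha>" "\<alpha> < 1"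
  shows "cond_prob M (\<lambda>\<omega>. 1 - cdf (\<kappa> (Z \<omega>)) (T \<omega>) \<le> \<alpha>) ev = \<alpha>"
proof -
  have \<kappa>_meas: "\<kappa> \<in> borel \<rightarrow>\<^sub>M prob_algebra borel"
    using \<kappa> by (simp add: regular_cond_distr_def)
  have [measurable]: "(\<lambda>\<omega>. cdf (\<kappa> (Z \<omega>)) (T \<omega>)) \<in> borel_measurable M"
    using measurable_cdf_kernel[OF \<kappa>_meas T Z] .
  have [measurable]: "(\<lambda>x. cdf (kernel (snd x)) (fst x)) \<in> borel_measurable (borel \<Otimes>\<^sub>M borel)"
    by (rule measurable_cdf_kernel) measurable
  have [measurable]: "(\<lambda>\<omega>. cdf (kernel (Z \<omega>)) (T \<omega>)) \<in> borel_measurable M"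
    by (rule measurable_cdf_kernel) measurable
  have atomless_k: "measure (kernel z) {t} = 0" for z t
  proof -
    have "emeasure law {t} = 0" using atomless by (simp add: law.emeasure_eq_measure)
    moreover have "emeasure law (slice z \<inter> {t}) \<le> emeasure law {t}"
      by (rule emeasure_mono) auto
    ultimately show ?thesis
      by (simp add: measure_def emeasure_kernel)
  qed
  have unif: "measure (kernel z) {t. 1 - cdf (kernel z) t \<le> \<alpha>} = \<alpha>" for z
    using real_distribution.prob_integral_transform[OF real_distribution_kernel atomless_k \<alpha>] .
  have "cond_prob M (\<lambda>\<omega>. 1 - cdf (\<kappa> (Z \<omega>)) (T \<omega>) \<le> \<alpha>) ev
      = measure M_ev {\<omega> \<in> space M. 1 - cdf (\<kappa> (Z \<omega>)) (T \<omega>) \<le> \<alpha>}"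
    unfolding M_ev_def cond_prob_def using ev_pos
    by (subst measure_uniform_measure)
      (auto simp: emeasure_eq_measure intro!: arg_cong2[of _ _ _ _ "(/)"] arg_cong[of _ _ "measure M"])
  also have "\<dots> = measure M_ev {\<omega> \<in> space M. 1 - cdf (kernel (Z \<omega>)) (T \<omega>) \<le> \<alpha>}"
    using regular_cdf_unique[OF \<kappa>] by (intro M_ev.finite_measure_eq_AE) auto
  also have "\<dots> = \<alpha>"
  proof -
    have "emeasure M_ev {\<omega> \<in> space M. 1 - cdf (kernel (Z \<omega>)) (T \<omega>) \<le> \<alpha>}
       = (\<integral>\<^sup>+\<omega>. indicator {x. 1 - cdf (kernel (snd x)) (fst x) \<le> \<alpha>} (T \<omega>, Z \<omega>) \<partial>M_ev)"
    proof -
      have "emeasure M_ev {\<omega> \<in> space M. 1 - cdf (kernel (Z \<omega>)) (T \<omega>) \<le> \<alpha>}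
        = (\<integral>\<^sup>+\<omega>. indicator {\<omega> \<in> space M. 1 - cdf (kernel (Z \<omega>)) (T \<omega>) \<le> \<alpha>} \<omega> \<partial>M_ev)"
        by (rule nn_integral_indicator[symmetric]) simp
      also have "\<dots> = (\<integral>\<^sup>+\<omega>. indicator {x. 1 - cdf (kernel (snd x)) (fst x) \<le> \<alpha>} (T \<omega>, Z \<omega>) \<partial>M_ev)"
        by (rule nn_integral_cong) (simp add: indicator_def)
      finally show ?thesis .
    qed
    also have "\<dots> = (\<integral>\<^sup>+\<omega>. (\<integral>\<^sup>+t. indicator {x. 1 - cdf (kernel (snd x)) (fst x) \<le> \<alpha>} (t, Z \<omega>) \<partial>kernel (Z \<omega>)) \<partial>M_ev)"
      by (rule disintegration) measurable
    also have "\<dots> = (\<integral>\<^sup>+\<omega>. ennreal \<alpha> \<partial>M_ev)"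
    proof (rule nn_integral_cong)
      fix \<omega>
      interpret k: real_distribution "kernel (Z \<omega>)" by (rule real_distribution_kernel)
      have [measurable]: "cdf (kernel (Z \<omega>)) \<in> borel_measurable borel" using k.cdf_nondecreasing by (intro borel_measurable_mono monoI)
      have "(\<integral>\<^sup>+t. indicator {x. 1 - cdf (kernel (snd x)) (fst x) \<le> \<alpha>} (t, Z \<omega>) \<partial>kernel (Z \<omega>))
         = (\<integral>\<^sup>+t. indicator {t. 1 - cdf (kernel (Z \<omega>)) t \<le> \<alpha>} t \<partial>kernel (Z \<omega>))"
        by (intro nn_integral_cong) (simp add: indicator_def)
      also have "\<dots> = emeasure (kernel (Z \<omega>)) {t. 1 - cdf (kernel (Z \<omega>)) t \<le> \<alpha>}"
        by (rule nn_integral_indicator) simp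
      finally show "(\<integral>\<^sup>+t. indicator {x. 1 - cdf (kernel (snd x)) (fst x) \<le> \<alpha>} (t, Z \<omega>) \<partial>kernel (Z \<omega>)) = ennreal \<alpha>"
        using unif[of "Z \<omega>"] by (simp add: k.emeasure_eq_measure)
    qed
    also have "\<dots> = ennreal \<alpha>" by (simp add: M_ev.emeasure_space_1[simplified])
    finally show ?thesis using \<alpha> by (simp add: measure_def)
  qed
  finally show ?thesis .
qed

end

subsection \<open>Projection of matrices onto the contrast space\<close>

lemma orth_proj_in: "subspace E \<Longrightarrow> orth_proj E *v x \<in> E"
  and orth_proj_orthogonal: "subspace E \<Longrightarrow> y \<in> E \<Longrightarrow> orthogonal (x - orth_proj E *v x) y"
  using theI'[OF orth_proj_ex1, of E] unfolding orth_proj_def by blast+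

lemma orthonormal_inner:
  assumes "pairwise orthogonal B" "\<And>b. b \<in> B \<Longrightarrow> norm b = 1" "b \<in> B" "b' \<in> B"
  shows "b \<bullet> b' = (if b = b' then 1 else 0)"
  using assms by (auto simp: pairwise_def orthogonal_def norm_eq_1)

lemma orthonormal_sum_inner:
  assumes "pairwise orthogonal B" "\<And>b. b \<in> B \<Longrightarrow> norm b = 1" "finite B" "b \<in> B"
  shows "(\<Sum>b'\<in>B. c b' *\<^sub>R b') \<bullet> b = c b"
proof -
  have "(\<Sum>b'\<in>B. c b' *\<^sub>R b') \<bullet> b = (\<Sum>b'\<in>B. if b' = b then c b' else 0)"
    unfolding inner_sum_left
    using orthonormal_inner[OF assms(1,2) _ assms(4)] by (intro sum.cong) simp_all
  then show ?thesis using assms by simp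
qed

text \<open>The difference of the two sides lies in the span and is orthogonal to it, hence to
  itself.\<close>

lemma orth_proj_orthonormal:
  fixes Q :: "(real^'n) set"
  assumes Q: "pairwise orthogonal Q" "\<And>e. e \<in> Q \<Longrightarrow> norm e = 1" "finite Q"
  shows "orth_proj (span Q) *v x = (\<Sum>e\<in>Q. (x \<bullet> e) *\<^sub>R e)"
proof -
  let ?p = "orth_proj (span Q) *v x" and ?s = "\<Sum>e\<in>Q. (x \<bullet> e) *\<^sub>R e"
  have sub: "subspace (span Q)" by simp
  have in_span: "?p - ?s \<in> span Q"
    by (intro span_diff span_sum span_scale orth_proj_in[OF sub]) (simp add: span_base)
  have "orthogonal (?p - ?s) e" if "e \<in> Q" for e
  proof -
    have "(x - ?p) \<bullet> e = 0"
      using orth_proj_orthogonal[OF sub, of e x] that by (simp add: orthogonal_def span_base)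
    then show ?thesis
      using orthonormal_sum_inner[OF Q that, of "\<lambda>e. x \<bullet> e"]
      by (simp add: orthogonal_def inner_diff_left)
  qed
  with in_span have "orthogonal (?p - ?s) (?p - ?s)"
    by (rule orthogonal_to_span)
  then show ?thesis by (simp add: orthogonal_self)
qed

text \<open>The rank-one matrix with \<open>e\<close> as column \<open>j\<close> and zeros
  elsewhere.\<close>

definition outer_col :: "real^'n \<Rightarrow> 'q \<Rightarrow> real^'q^'n" where
  "outer_col e j = (\<chi> i. e $ i *\<^sub>R axis j 1)"

lemma inner_outer_col: "A \<bullet> outer_col e j = column j A \<bullet> e"
  by (simp add: inner_vec_def outer_col_def column_def axis_def if_distrib mult_ac cong: if_cong)

lemma column_outer_col: "column k (outer_col e j) = (if k = j then e else 0)"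
  by (auto simp: column_def outer_col_def axis_def vec_eq_iff)

text \<open>Left multiplication by the projection acts on each column separately, so its range is a
  copy of the span in each of the q columns. This is the origin of the factor q in the degrees of
  freedom.\<close>

lemma outer_col_orthonormal:
  fixes Q :: "(real^'n) set"
  assumes Q: "pairwise orthogonal Q" "\<And>e. e \<in> Q \<Longrightarrow> norm e = 1" "finite Q"
  defines "B \<equiv> (\<lambda>(e, j). outer_col e j :: real^'q^'n) ` (Q \<times> UNIV)"
  shows "pairwise orthogonal B" "\<And>b. b \<in> B \<Longrightarrow> norm b = 1" "finite B"
    "card B = CARD('q) * card Q"
    "orth_proj (span Q) ** A = (\<Sum>b\<in>B. (A \<bullet> b) *\<^sub>R b)"
proof -
  have ip: "outer_col e j \<bullet> outer_col e' j' = (if e = e' \<and> j = j' then 1 else 0)"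
    if "e \<in> Q" "e' \<in> Q" for e e' and j j' :: 'q
    using orthonormal_inner[OF Q(1,2) that]
    by (auto simp: inner_outer_col column_outer_col)
  show "pairwise orthogonal B"
    unfolding B_def pairwise_def orthogonal_def by (auto simp: ip)
  show "norm b = 1" if "b \<in> B" for b
    using that unfolding B_def norm_eq_1 by (auto simp: ip)
  show "finite B" using Q(3) by (simp add: B_def)
  have inj: "inj_on (\<lambda>(e, j). outer_col e j :: real^'q^'n) (Q \<times> UNIV)"
  proof (rule inj_onI, clarsimp)
    fix e e' and j j' :: 'q
    assume "e \<in> Q" "e' \<in> Q" and eq: "(outer_col e j :: real^'q^'n) = outer_col e' j'"
    then show "e = e' \<and> j = j'"
      using ip[of e e' j j'] ip[of e' e' j' j'] by (auto split: if_splits)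
  qed
  then show "card B = CARD('q) * card Q"
    by (simp add: B_def card_image card_cartesian_product)
  have "column k (orth_proj (span Q) ** A) = column k (\<Sum>b\<in>B. (A \<bullet> b) *\<^sub>R b)" for k
  proof -
    have "(\<Sum>b\<in>B. (A \<bullet> b) *\<^sub>R b) = (\<Sum>(e, j)\<in>Q \<times> UNIV. (column j A \<bullet> e) *\<^sub>R outer_col e j)"
      unfolding B_def using inj by (simp add: sum.reindex case_prod_unfold comp_def inner_outer_col)
    also have "\<dots> = (\<Sum>e\<in>Q. \<Sum>j\<in>UNIV. (column j A \<bullet> e) *\<^sub>R outer_col e j)"
      by (simp add: sum.cartesian_product)
    finally have "column k (\<Sum>b\<in>B. (A \<bullet> b) *\<^sub>R b)
        = (\<Sum>e\<in>Q. \<Sum>j\<in>UNIV. (column j A \<bullet> e) *\<^sub>R column k (outer_col e j))"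
      by (simp add: vec_eq_iff column_def)
    also have "\<dots> = (\<Sum>e\<in>Q. (column k A \<bullet> e) *\<^sub>R e)"
      by (rule sum.cong) (simp_all add: column_outer_col if_distrib[of "scaleR _"] cong: if_cong)
    also have "\<dots> = orth_proj (span Q) *v column k A"
      by (rule orth_proj_orthonormal[OF Q, symmetric])
    also have "\<dots> = column k (orth_proj (span Q) ** A)"
      by (simp add: vec_eq_iff column_def matrix_vector_mult_def matrix_matrix_mult_def)
    finally show ?thesis by simp
  qed
  then show "orth_proj (span Q) ** A = (\<Sum>b\<in>B. (A \<bullet> b) *\<^sub>R b)"
    by (simp add: vec_eq_iff column_def)
qed

lemma matrix_complement_mult: "(mat 1 - P) ** A = A - P ** (A :: real^'q^'n)"
proof -
  have "(mat 1 - P) ** A = mat 1 ** A - P ** A"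
    by (simp only: vec_eq_iff matrix_matrix_mult_def) (simp add: left_diff_distrib sum_subtractf)
  then show ?thesis by simp
qed

lemma contrast_inner:
  fixes \<mu> :: "real^'q^'n"
  shows "column j \<mu> \<bullet> contrast C k k' = row_mean \<mu> (C k) $ j - row_mean \<mu> (C k') $ j"
proof -
  have mean: "(\<Sum>i\<in>UNIV. \<mu> $ i $ j * (indicator (C l) i / real (card (C l)))) = row_mean \<mu> (C l) $ j" for l
  proof -
    have "(\<Sum>i\<in>UNIV. \<mu> $ i $ j * (indicator (C l) i / real (card (C l))))
        = (\<Sum>i\<in>UNIV. if i \<in> C l then \<mu> $ i $ j / real (card (C l)) else 0)"
      by (rule sum.cong) (auto simp: indicator_def)
    also have "\<dots> = (\<Sum>i\<in>C l. \<mu> $ i $ j / real (card (C l)))"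
      by (simp add: sum.If_cases)
    finally show ?thesis by (simp add: row_mean_def sum_divide_distrib)
  qed
  show ?thesis
    unfolding mean[symmetric]
    by (simp add: inner_vec_def column_def contrast_def right_diff_distrib sum_subtractf)
qed

lemma contrast_space_inner_zero:
  fixes \<mu> :: "real^'q^'n"
  assumes "\<And>k k'. (k, k') \<in> V \<Longrightarrow> row_mean \<mu> (C k) = row_mean \<mu> (C k')"
    and "e \<in> contrast_space C V"
  shows "column j \<mu> \<bullet> e = 0"
proof -
  have "orthogonal (column j \<mu>) e"
    using assms(2) unfolding contrast_space_def
    by (rule orthogonal_to_span) (auto simp: orthogonal_def contrast_inner assms(1))
  then show ?thesis by (simp add: orthogonal_def)
qed

text \<open>At an index in \<open>C k\<close> the second indicator vanishes by disjointness, leaving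
  the nonzero entry 1 / |C k|.\<close>

lemma contrast_space_dim_pos:
  assumes "(k, k') \<in> V" "C k \<noteq> {}" "C k \<inter> C k' = {}"
  shows "0 < dim (contrast_space C V)"
proof -
  obtain i where i: "i \<in> C k" using assms by auto
  then have "contrast C k k' $ i \<noteq> 0"
    using assms(3) by (auto simp: contrast_def indicator_def card_gt_0_iff)
  then have "contrast C k k' \<noteq> 0" by auto
  moreover have "contrast C k k' \<in> contrast_space C V"
    unfolding contrast_space_def using assms(1) by (auto intro: span_base)
  ultimately have "\<not> contrast_space C V \<subseteq> {0}" by auto
  then show ?thesis by (metis dim_eq_0 gr0I)
qed

subsection \<open>Measurability of K-means\<close>

text \<open>The set of nearest labels takes finitely many values, each on an event given by finitely
  many comparisons of distances; an arbitrary \<open>tie\<close> is then a map on a discrete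
  space.\<close>

lemma measurable_nearest_center:
  fixes m :: "'a \<Rightarrow> nat \<Rightarrow> real^'q"
  assumes [measurable]: "\<And>l. (\<lambda>x. m x l) \<in> borel_measurable N" "f \<in> borel_measurable N"
  shows "(\<lambda>x. nearest_center tie K (m x) (f x)) \<in> N \<rightarrow>\<^sub>M count_space UNIV"
proof -
  define L where "L x = {l \<in> {1..K}. \<forall>l'\<in>{1..K}. norm (f x - m x l) \<le> norm (f x - m x l')}" for x
  have "L \<in> N \<rightarrow>\<^sub>M count_space (Pow {1..K})"
  proof (subst measurable_count_space_eq2)
    have "L -` {S} \<inter> space N \<in> sets N" if "S \<in> Pow {1..K}" for S
    proof -
      have "L -` {S} \<inter> space N = {x \<in> space N. \<forall>l\<in>{1..K}. l \<in> S \<longleftrightarrow>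
          (\<forall>l'\<in>{1..K}. norm (f x - m x l) \<le> norm (f x - m x l'))}"
        using that by (auto simp: L_def set_eq_iff)
      also have "\<dots> \<in> sets N" by measurable
      finally show ?thesis .
    qed
    then show "L \<in> space N \<rightarrow> Pow {1..K} \<and> (\<forall>S\<in>Pow {1..K}. L -` {S} \<inter> space N \<in> sets N)"
      by (auto simp: L_def)
  qed simp
  then have "(\<lambda>x. tie (L x)) \<in> N \<rightarrow>\<^sub>M count_space UNIV"
    by (rule measurable_compose) simp
  then show ?thesis by (simp add: nearest_center_def L_def)
qed

lemma measurable_pointwise_count_space:
  fixes f :: "'a \<Rightarrow> 'n::finite \<Rightarrow> 'b::countable"
  assumes [measurable]: "\<And>i. (\<lambda>x. f x i) \<in> N \<rightarrow>\<^sub>M count_space UNIV"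
  shows "f \<in> N \<rightarrow>\<^sub>M count_space UNIV"
proof (subst measurable_count_space_eq2_countable)
  have "f -` {c} \<inter> space N = {x \<in> space N. \<forall>i. f x i = c i}" for c by auto
  also have "{x \<in> space N. \<forall>i. f x i = c i} \<in> sets N" for c by measurable
  finally show "f \<in> space N \<rightarrow> UNIV \<and> (\<forall>c\<in>UNIV. f -` {c} \<inter> space N \<in> sets N)" by auto
qed

lemma borel_measurable_vec_nth [measurable]: "(\<lambda>A :: ('a::euclidean_space)^'n. A $ i) \<in> borel_measurable borel"
  by (intro borel_measurable_continuous_onI continuous_intros)

lemma borel_measurable_row_mean [measurable]: "(\<lambda>A. row_mean A S) \<in> borel_measurable borel"
  unfolding row_mean_def by measurable

lemma measurable_kmeans_assign [measurable]:
  "(\<lambda>A :: real^'q^'n. kmeans_assign tie K init A j) \<in> borel \<rightarrow>\<^sub>M count_space UNIV"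
proof (induction j)
  case 0
  show ?case
    by (rule measurable_pointwise_count_space) (simp add: measurable_nearest_center)
next
  case (Suc j)
  show ?case
  proof (rule measurable_pointwise_count_space)
    fix i
    \<comment> \<open>With the previous assignment frozen at \<open>c\<close> the centers are fixed
      averages of rows. The possible \<open>c\<close> are countably many, so the pieces can be glued
      along the previous step.\<close>
    have "(\<lambda>A :: real^'q^'n. nearest_center tie K (\<lambda>l. row_mean A {s. c s = l}) (A $ i))
        \<in> borel \<rightarrow>\<^sub>M count_space UNIV" for c
      by (intro measurable_nearest_center) measurable
    from measurable_compose_countable[OF this Suc.IH]
    show "(\<lambda>A :: real^'q^'n. kmeans_assign tie K init A (Suc j) i) \<in> borel \<rightarrow>\<^sub>M count_space UNIV"
      by simp
  qed
qed

lemma kmeans_eq_sets [measurable]: "{A :: real^'q^'n. kmeans tie K init J A = Some c} \<in> sets borel"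
proof -
  have "{A :: real^'q^'n. kmeans tie K init J A = Some c} =
    {A \<in> space borel. length c = Suc J \<and> (\<forall>j\<in>{..J}. kmeans_assign tie K init A j = c ! j \<and>
      (\<forall>l\<in>{1..K}. {i. (c ! j) i = l} \<noteq> {}))}"
    by (auto simp: kmeans_def list_eq_iff_nth_eq less_Suc_eq_le simp del: upt_Suc)
  also have "\<dots> \<in> sets borel" by measurable
  finally show ?thesis .
qed

subsection \<open>Matrices with independent Gaussian rows\<close>

lemma prod_Basis_vec:
  fixes F :: "('a::euclidean_space)^'n \<Rightarrow> 'b::comm_monoid_mult"
  shows "(\<Prod>b\<in>Basis. F b) = (\<Prod>i\<in>UNIV. \<Prod>u\<in>Basis. F (axis i u))"
proof -
  have inj: "inj_on (\<lambda>(i, u). axis i u :: 'a^'n) (UNIV \<times> Basis)"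
    by (auto simp: inj_on_def axis_eq_axis nonzero_Basis)
  have "(Basis :: ('a^'n) set) = (\<lambda>(i, u). axis i u) ` (UNIV \<times> Basis)"
    unfolding Basis_vec_def by auto
  then have "(\<Prod>b\<in>Basis. F b) = (\<Prod>b\<in>(\<lambda>(i, u). axis i u) ` (UNIV \<times> Basis). F b)"
    by (simp only:)
  also have "\<dots> = (\<Prod>(i, u)\<in>UNIV \<times> Basis. F (axis i u))"
    by (subst prod.reindex[OF inj]) (simp add: case_prod_unfold)
  finally show ?thesis by (simp add: prod.cartesian_product)
qed

lemma iso_normal_density_eq: "iso_normal_density m \<sigma> x = isotropic_density m \<sigma> x"
  by (simp add: iso_normal_density_def isotropic_density_def)

lemma nn_integral_isotropic_density_box:
  fixes m l u :: "'a::euclidean_space"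
  shows "(\<integral>\<^sup>+x. ennreal (isotropic_density m \<sigma> x) * indicator (box l u) x \<partial>lborel)
    = (\<Prod>b\<in>Basis. \<integral>\<^sup>+t. ennreal (normal_density (m \<bullet> b) \<sigma> t) * indicator {l \<bullet> b<..<u \<bullet> b} t \<partial>lborel)"
proof -
  have "ennreal (isotropic_density m \<sigma> x) * indicator (box l u) x
      = (\<Prod>b\<in>Basis. ennreal (normal_density (m \<bullet> b) \<sigma> (x \<bullet> b)) * indicator {l \<bullet> b<..<u \<bullet> b} (x \<bullet> b))" for x
  proof -
    have "indicator (box l u) x = (\<Prod>b\<in>Basis. indicator {l \<bullet> b<..<u \<bullet> b} (x \<bullet> b) :: ennreal)"
      by (auto simp: indicator_def box_def prod_zero_iff)
    then show ?thesis
      by (simp add: isotropic_density_prod prod_ennreal[symmetric] prod.distrib)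
  qed
  then show ?thesis
    by (simp only:) (rule nn_integral_lborel_prod
      [where f="\<lambda>b t. ennreal (normal_density (m \<bullet> b) \<sigma> t) * indicator {l \<bullet> b<..<u \<bullet> b} t"], auto)
qed

text \<open>On a box both laws factor: independence splits the probability over rows, and the
  product density splits over all entries. Boxes are stable under intersection, generate the Borel
  sets and exhaust the space.\<close>

lemma isotropic_matrix_distributed:
  fixes X :: "'w \<Rightarrow> real^'q^'n" and \<mu> :: "real^'q^'n"
  assumes "prob_space M"
    and ind: "prob_space.indep_vars M (\<lambda>_. borel) (\<lambda>i \<omega>. X \<omega> $ i) UNIV"
    and row: "\<And>i. distributed M lborel (\<lambda>\<omega>. X \<omega> $ i) (\<lambda>x. ennreal (iso_normal_density (\<mu> $ i) \<sigma> x))"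
  shows "distributed M lborel X (\<lambda>x. ennreal (isotropic_density \<mu> \<sigma> x))"
proof -
  interpret prob_space M by fact
  have [measurable]: "(\<lambda>\<omega>. X \<omega> $ i) \<in> borel_measurable M" for i
    using distributed_measurable[OF row] by simp
  have X_meas [measurable]: "X \<in> borel_measurable M"
  proof (subst borel_measurable_euclidean_space)
    show "\<forall>b\<in>Basis. (\<lambda>\<omega>. X \<omega> \<bullet> b) \<in> borel_measurable M"
    proof
      fix b :: "real^'q^'n" assume "b \<in> Basis"
      then obtain i u where "b = axis i u" by (auto simp: Basis_vec_def)
      then show "(\<lambda>\<omega>. X \<omega> \<bullet> b) \<in> borel_measurable M" by (simp add: inner_axis)
    qed
  qed
  have box_vec: "x \<in> box l u \<longleftrightarrow> (\<forall>i. x $ i \<in> box (l $ i) (u $ i))" for x l u :: "real^'q^'n"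
    by (auto simp: box_def Basis_vec_def inner_axis)
  have "density lborel (\<lambda>x. ennreal (isotropic_density \<mu> \<sigma> x)) = distr M borel X"
  proof (rule measure_eqI_generator_eq)
    let ?E = "range (\<lambda>(a, b). box a b :: (real^'q^'n) set)"
    show "Int_stable ?E" by (auto simp: Int_stable_def box_Int_box)
    show "?E \<subseteq> Pow UNIV"
      "sets (density lborel (\<lambda>x. ennreal (isotropic_density \<mu> \<sigma> x))) = sigma_sets UNIV ?E"
      "sets (distr M borel X) = sigma_sets UNIV ?E"
      by (simp_all add: borel_eq_box)
    let ?A = "\<lambda>n::nat. box (- (real n *\<^sub>R One)) (real n *\<^sub>R One) :: (real^'q^'n) set"
    show "range ?A \<subseteq> ?E" "(\<Union>i. ?A i) = UNIV"
      unfolding UN_box_eq_UNIV by auto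
    have eq: "emeasure (density lborel (\<lambda>x. ennreal (isotropic_density \<mu> \<sigma> x))) (box l u)
      = emeasure (distr M borel X) (box l u)" for l u
    proof -
      have "emeasure (distr M borel X) (box l u)
          = emeasure M (\<Inter>i\<in>UNIV. (\<lambda>\<omega>. X \<omega> $ i) -` box (l $ i) (u $ i) \<inter> space M)"
        by (subst emeasure_distr) (auto simp: box_vec intro!: arg_cong[of _ _ "emeasure M"])
      also have "\<dots> = (\<Prod>i\<in>UNIV. emeasure M ((\<lambda>\<omega>. X \<omega> $ i) -` box (l $ i) (u $ i) \<inter> space M))"
        unfolding emeasure_eq_measure
        by (subst indep_varsD[OF ind]) (auto simp: prod_ennreal)
      also have "\<dots> = (\<Prod>i\<in>UNIV. \<integral>\<^sup>+x. ennreal (isotropic_density (\<mu> $ i) \<sigma> x) * indicator (box (l $ i) (u $ i)) x \<partial>lborel)"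
        by (subst distributed_emeasure[OF row]) (auto simp: iso_normal_density_eq)
      also have "\<dots> = (\<integral>\<^sup>+x. ennreal (isotropic_density \<mu> \<sigma> x) * indicator (box l u) x \<partial>lborel)"
        by (simp add: nn_integral_isotropic_density_box prod_Basis_vec inner_axis)
      finally show ?thesis by (simp add: emeasure_density)
    qed
    show "emeasure (density lborel (\<lambda>x. ennreal (isotropic_density \<mu> \<sigma> x))) S = emeasure (distr M borel X) S"
      if "S \<in> ?E" for S
      using that eq by auto
    show "emeasure (density lborel (\<lambda>x. ennreal (isotropic_density \<mu> \<sigma> x))) (?A i) \<noteq> \<infinity>" for i
      unfolding eq by (subst emeasure_distr) (auto simp: emeasure_eq_measure)
  qed
  then show ?thesis
    by (auto simp: distributed_def cong: distr_cong)
qed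

subsection \<open>The selective test\<close>

lemma gaussian_projection_orthonormal:
  fixes X :: "'w \<Rightarrow> 'a::euclidean_space"
  assumes "prob_space M" and "0 < \<sigma>"
    and "distributed M lborel X (\<lambda>x. ennreal (isotropic_density m \<sigma> x))"
    and B: "pairwise orthogonal B" "\<And>b. b \<in> B \<Longrightarrow> norm b = 1" "finite B" and "B \<noteq> {}"
    and m: "\<And>b. b \<in> B \<Longrightarrow> m \<bullet> b = 0"
  shows "gaussian_projection M X m \<sigma> (\<lambda>x. \<Sum>b\<in>B. (x \<bullet> b) *\<^sub>R b)"
proof -
  interpret prob_space M by fact
  let ?p = "\<lambda>x. \<Sum>b\<in>B. (x \<bullet> b) *\<^sub>R b"
  have p_inner: "?p x \<bullet> b = x \<bullet> b" if "b \<in> B" for x b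
    using orthonormal_sum_inner[OF B that] .
  show ?thesis
  proof
    show "?p (x + y) = ?p x + ?p y" for x y
      by (simp add: inner_add_left scaleR_add_left sum.distrib)
    show "?p (r *\<^sub>R x) = r *\<^sub>R ?p x" for r x
      by (simp add: scaleR_sum_right)
    show "?p (?p x) = ?p x" for x
      by (rule sum.cong) (simp_all add: p_inner)
    show "(x - ?p x) \<bullet> ?p y = 0" for x y
    proof -
      have "(x - ?p x) \<bullet> ?p y = (\<Sum>b\<in>B. (y \<bullet> b) * (x \<bullet> b - ?p x \<bullet> b))"
        by (simp add: inner_sum_right inner_diff_left)
      also have "\<dots> = 0"
        by (intro sum.neutral ballI) (simp add: p_inner)
      finally show ?thesis .
    qed
    show "?p m = 0" by (simp add: m)
    obtain b where "b \<in> B" using \<open>B \<noteq> {}\<close> by auto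
    then have "?p b \<bullet> b = 1" using B(2) by (simp add: p_inner norm_eq_1)
    then have "?p b \<noteq> 0" by auto
    then show "\<exists>z. ?p z \<noteq> 0" by blast
  qed (use assms in auto)
qed

text \<open>At \<psi> = T the perturbed data set is the observed one; this lets the selection event
  be read off from (T, Z).\<close>

lemma perturbed_test_stat:
  assumes "P ** A \<noteq> 0" "0 < \<sigma>"
  shows "(test_stat P \<sigma> A * \<sigma>) *\<^sub>R fst (direction_and_rest P A) + snd (direction_and_rest P A) = A"
  using assms by (simp add: test_stat_def direction_and_rest_def matrix_complement_mult)

theorem theorem3:
  fixes M :: "'w measure" and X :: "'w \<Rightarrow> real^'q^'n" and \<mu> :: "real^'q^'n" and \<sigma> :: real
    and K J d :: nat and tie :: "nat set \<Rightarrow> nat" and init :: "nat \<Rightarrow> 'n"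
    and sel :: "real^'q^'n \<Rightarrow> (nat \<times> nat) set"
    and c0 :: "('n \<Rightarrow> nat) list" and V :: "(nat \<times> nat) set" and C :: "nat \<Rightarrow> 'n set"
    and \<C> :: "real^'q^'n \<Rightarrow> ('n \<Rightarrow> nat) list option"
    and \<E> :: "(real^'n) set" and P :: "real^'n^'n"
    and ev :: "'w \<Rightarrow> bool" and M\<^sub>e\<^sub>v :: "'w measure"
    and T :: "'w \<Rightarrow> real" and Z :: "'w \<Rightarrow> (real^'q^'n) \<times> (real^'q^'n)" and S :: "'w \<Rightarrow> real set"
  assumes "prob_space M"
    and "2 \<le> K" and "K \<le> CARD('n)" and "1 \<le> J" and "0 < \<sigma>"
    and "prob_space.indep_vars M (\<lambda>_. borel) (\<lambda>i \<omega>. X \<omega> $ i) UNIV"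
    and "\<And>i. distributed M lborel (\<lambda>\<omega>. X \<omega> $ i) (\<lambda>x. ennreal (iso_normal_density (\<mu> $ i) \<sigma> x))"
    and "tie_rule K tie" and "inj_on init {1..K}"
    and "\<C> = kmeans tie K init J"
    and "sel \<in> borel \<rightarrow>\<^sub>M count_space UNIV"
    and "\<And>A. sel A \<noteq> {}" and "\<And>A. sel A \<subseteq> all_pairs K"
    and "ev = (\<lambda>\<omega>. \<C> (X \<omega>) = Some c0 \<and> sel (X \<omega>) = V)"
    and "\<P>(\<omega> in M. ev \<omega>) > 0"
    and "\<And>j k. j \<le> J \<Longrightarrow> k \<in> {1..K} \<Longrightarrow> {i. (c0 ! j) i = k} \<noteq> {}"
    and "C = (\<lambda>k. {i. (c0 ! J) i = k})"
    and "\<And>k k'. (k, k') \<in> V \<Longrightarrow> row_mean \<mu> (C k) = row_mean \<mu> (C k')"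
    and "\<E> = contrast_space C V"
    and "P = orth_proj \<E>"
    and "d = CARD('q) * dim \<E>"
    and "T = (\<lambda>\<omega>. test_stat P \<sigma> (X \<omega>))"
    and "Z = (\<lambda>\<omega>. direction_and_rest P (X \<omega>))"
    and "S = (\<lambda>\<omega>. invariance_set \<C> P \<sigma> (X \<omega>) \<inter> invariance_set sel P \<sigma> (X \<omega>))"
    and "M\<^sub>e\<^sub>v = uniform_measure M {\<omega> \<in> space M. ev \<omega>}"
  shows "(\<exists>\<kappa>. regular_cond_distr M\<^sub>e\<^sub>v T Z \<kappa>) \<and>
    (\<forall>\<kappa>. regular_cond_distr M\<^sub>e\<^sub>v T Z \<kappa> \<longrightarrow>
       (AE \<omega> in M\<^sub>e\<^sub>v. cdf (\<kappa> (Z \<omega>)) = truncated_cdf (chi d) (S \<omega>)) \<and>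
       (\<forall>\<alpha>. 0 < \<alpha> \<and> \<alpha> < 1 \<longrightarrow>
          \<P>(\<omega> in M. 1 - cdf (\<kappa> (Z \<omega>)) (T \<omega>) \<le> \<alpha> \<bar> ev \<omega>) = \<alpha>))"
proof -
  interpret prob_space M by fact
  note \<C>_def = assms(10) and ev_def = assms(14) and C_def = assms(17) and \<E>_def = assms(19)
    and P_def = assms(20) and d_def = assms(21) and T_def = assms(22) and Z_def = assms(23)
    and S_def = assms(24) and Mev_def = assms(25)
  note \<open>sel \<in> borel \<rightarrow>\<^sub>M count_space UNIV\<close> [measurable]
  have X: "distributed M lborel X (\<lambda>x. ennreal (isotropic_density \<mu> \<sigma> x))"
    using assms by (intro isotropic_matrix_distributed)
  \<comment> \<open>Positive probability yields an outcome at which \<open>sel\<close> equals V, so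
    V inherits nonemptiness and containment in \<open>all_pairs K\<close>.\<close>
  obtain k k' where "(k, k') \<in> V" "k \<in> {1..K}" "k \<noteq> k'"
  proof -
    have "{\<omega> \<in> space M. ev \<omega>} \<noteq> {}" using \<open>\<P>(\<omega> in M. ev \<omega>) > 0\<close> by force
    then obtain \<omega> where "sel (X \<omega>) = V" using ev_def by auto
    then have "V \<noteq> {}" "V \<subseteq> all_pairs K" using assms(12)[of "X \<omega>"] assms(13)[of "X \<omega>"] by auto
    then show thesis using that by (auto simp: all_pairs_def)
  qed
  then have dim_pos: "0 < dim \<E>"
    unfolding \<E>_def using assms(16)[of J k] C_def by (intro contrast_space_dim_pos[of k k']) auto
  have "subspace \<E>" unfolding \<E>_def contrast_space_def by simp
  then obtain Q where Q: "Q \<subseteq> \<E>" "pairwise orthogonal Q" "\<And>e. e \<in> Q \<Longrightarrow> norm e = 1"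
    "independent Q" "card Q = dim \<E>" "span Q = \<E>"
    by (metis orthonormal_basis_subspace)
  have "finite Q" using Q(4) by (rule independent_imp_finite)
  define B where "B = (\<lambda>(e, j). outer_col e j :: real^'q^'n) ` (Q \<times> UNIV)"
  note B = outer_col_orthonormal[OF Q(2,3) \<open>finite Q\<close>, where 'q='q, folded B_def]
  have card_B: "card B = d" using B(4) Q(5) d_def by simp
  have P_sum: "P ** A = (\<Sum>b\<in>B. (A \<bullet> b) *\<^sub>R b)" for A :: "real^'q^'n"
    using B(5) Q(6) P_def by simp
  have \<mu>B: "\<mu> \<bullet> b = 0" if "b \<in> B" for b
  proof -
    obtain e j where "b = outer_col e j" "e \<in> Q" using \<open>b \<in> B\<close> by (auto simp: B_def)
    then show ?thesis
      using contrast_space_inner_zero[OF assms(18), where e=e] Q(1) \<E>_def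
      by (auto simp: inner_outer_col)
  qed
  have "0 < d"
    unfolding d_def by (rule mult_pos_pos[OF zero_less_card_finite dim_pos])
  then have "B \<noteq> {}" using card_B by force
  interpret gaussian_projection M X \<mu> \<sigma> "\<lambda>A. P ** A"
    unfolding P_sum
    by (rule gaussian_projection_orthonormal[OF _ _ X B(1-3) \<open>B \<noteq> {}\<close> \<mu>B]) fact+
  have T_eq: "T = (\<lambda>\<omega>. radius (X \<omega>) / \<sigma>)"
    unfolding T_def radius_def test_stat_def ..
  have Z_eq: "Z = (\<lambda>\<omega>. shape (X \<omega>))"
    unfolding Z_def shape_def direction_and_rest_def matrix_complement_mult ..
  have law_T: "distr M borel T = chi d"
    unfolding T_eq radius_def P_sum card_B[symmetric]
    by (rule distr_norm_projection_chi[OF _ _ X B(1,2) \<mu>B]) fact+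
  \<comment> \<open>Rebuilds a matrix from a radius in units of \<sigma> and a direction-remainder
    pair; with z = Z(\<omega>) it is \<open>perturbed\<close> as a function of \<psi>.\<close>
  define x where "x = (\<lambda>(t, z). (t * \<sigma>) *\<^sub>R fst z + snd z :: real^'q^'n)"
  have [measurable]: "fst \<in> borel_measurable (borel :: ((real^'q^'n) \<times> (real^'q^'n)) measure)"
    "snd \<in> borel_measurable (borel :: ((real^'q^'n) \<times> (real^'q^'n)) measure)"
    by (auto intro!: borel_measurable_continuous_onI continuous_on_fst continuous_on_snd)
  have x_meas [measurable]: "x \<in> borel \<Otimes>\<^sub>M borel \<rightarrow>\<^sub>M borel"
    unfolding x_def by measurable
  have sel_V [measurable]: "{A. sel A = V} \<in> sets borel"
  proof -
    have "sel -` {V} \<inter> space borel \<in> sets borel"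
      by (rule measurable_sets[OF \<open>sel \<in> borel \<rightarrow>\<^sub>M count_space UNIV\<close>]) simp
    then show ?thesis by (simp add: vimage_def)
  qed
  define G where "G = {A. \<C> A = Some c0} \<inter> {A. sel A = V}"
  have [measurable]: "G \<in> sets borel"
    unfolding G_def \<C>_def by measurable
  \<comment> \<open>The sign condition matches \<psi> \<ge> 0 in \<open>invariance_set\<close>; it
    costs nothing on the event, because T is nonnegative.\<close>
  define E where "E = {y \<in> space (borel \<Otimes>\<^sub>M borel). 0 \<le> fst y \<and> x y \<in> G}"
  have E_meas [measurable]: "E \<in> sets (borel \<Otimes>\<^sub>M borel)"
    unfolding E_def by measurable
  have ev_G: "ev \<omega> \<longleftrightarrow> X \<omega> \<in> G" for \<omega>
    using ev_def by (simp add: G_def)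
  have "AE \<omega> in M. ev \<omega> \<longleftrightarrow> (T \<omega>, Z \<omega>) \<in> E"
    using AE_p_nonzero
  proof eventually_elim
    case (elim \<omega>)
    then have "x (T \<omega>, Z \<omega>) = X \<omega>"
      unfolding x_def T_def Z_def using perturbed_test_stat \<open>0 < \<sigma>\<close> by simp
    moreover have "0 \<le> T \<omega>"
      using \<open>0 < \<sigma>\<close> by (simp add: T_def test_stat_def)
    ultimately show ?case by (simp add: E_def ev_G space_pair_measure)
  qed
  then interpret truncated_independent M T Z E ev
    using distr_radius_shape \<open>\<P>(\<omega> in M. ev \<omega>) > 0\<close>
    by unfold_locales (auto simp: T_eq Z_eq ev_G)
  have M_ev_eq: "M\<^sub>e\<^sub>v = M_ev"
    using Mev_def by (simp add: M_ev_def)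
  have law_eq: "law = chi d" by (simp add: law_def law_T)
  \<comment> \<open>The slice compares outcomes with the fixed values c0 and V, whereas
    \<open>S\<close> compares them with those at X(\<omega>); on the event these agree.\<close>
  have slice_eq: "slice (Z \<omega>) = S \<omega>" if "ev \<omega>" for \<omega>
  proof -
    have x_eq: "perturbed P \<sigma> (X \<omega>) \<psi> = x (\<psi>, Z \<omega>)" for \<psi>
      by (simp add: perturbed_def x_def Z_def direction_and_rest_def mult_ac)
    have "slice (Z \<omega>) = {\<psi>. 0 \<le> \<psi> \<and> x (\<psi>, Z \<omega>) \<in> G}"
      unfolding slice_def by (simp add: E_def space_pair_measure)
    also have "\<dots> = {\<psi>. 0 \<le> \<psi> \<and> \<C> (X \<omega>) = \<C> (x (\<psi>, Z \<omega>)) \<and> sel (X \<omega>) = sel (x (\<psi>, Z \<omega>))}"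
      using that unfolding ev_def G_def by auto
    also have "\<dots> = S \<omega>"
      unfolding S_def invariance_set_def x_eq by blast
    finally show ?thesis .
  qed
  have AE_ev: "AE \<omega> in M_ev. ev \<omega>"
    unfolding M_ev_def by (rule AE_uniform_measureI) (auto intro!: AE_I2)
  show ?thesis
    unfolding M_ev_eq
  proof (intro conjI allI impI)
    show "\<exists>\<kappa>. regular_cond_distr M_ev T Z \<kappa>"
      using regular_kernel by blast
    fix \<kappa> assume \<kappa>: "regular_cond_distr M_ev T Z \<kappa>"
    show "AE \<omega> in M_ev. cdf (\<kappa> (Z \<omega>)) = truncated_cdf (chi d) (S \<omega>)"
      using regular_cdf_truncated[OF \<kappa>] AE_ev
      by eventually_elim (simp add: slice_eq law_eq)
    fix \<alpha> :: real assume "0 < \<alpha> \<and> \<alpha> < 1"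
    moreover have "measure law {t} = 0" for t
      unfolding law_def unfolding T_eq by (rule radius_no_atoms)
    ultimately show "\<P>(\<omega> in M. 1 - cdf (\<kappa> (Z \<omega>)) (T \<omega>) \<le> \<alpha> \<bar> ev \<omega>) = \<alpha>"
      by (intro p_value_uniform[OF \<kappa>]) auto
  qed
qed

end
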